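(* Consider the locally connected two-dimensional square cellular downlink network described in the context, with no channel state information at the transmitters. Its optimal DoF value is $4/5$ DoF per cell.
   Context: Cells are indexed by $(i,j)\in\mathbb{Z}^2$ on a square grid; each cell shares a boundary with its 4 grid neighbours. Each cell has one single-antenna base station and four single-antenna users, one located on each of its 4 boundaries. Each base station has 4 independent messages, one for each of its users. A user located on the boundary between two adjacent cells hears exactly the two base stations of those cells and no others (local connectivity). At channel use $n$, receiver $r$ observes $Y_r(n)=\sum_{t} c_{rt}H_{rt}(n)X_t(n)+Z_r(n)$, where $c_{rt}\in\{0,1\}$ is the fixed connectivity indicator just described, $H_{rt}(n)$ are complex channel coefficients with magnitudes in a fixed interval bounded away from $0$ and $\infty$ (otherwise arbitrary), $Z_r(n)$ is i.i.d. zero-mean unit-variance circularly symmetric complex Gaussian noise, and $E|X_t|^2\le P$. Each receiver knows its channels from the transmitters it hears. No CSIT: transmitters know the connectivity but not channel realizations. The DoF of a message is its rate normalized by $\log P$ as $P\to\infty$; DoF per cell is the sum of the DoF of a cell's messages, measured symmetrically, i.e., the largest value that all cells can simultaneously achieve. *)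

theory Defs
  imports "HOL-Probability.Probability"
begin

text \<open>Square cellular downlink, local connectivity, no CSIT.
  Cells are indexed by int \<times> int. Each cell has four users, one on each of its
  four boundaries (directions). User (c,d) belongs to cell c, sits on the boundary
  between c and its neighbour nb c d, and hears exactly the base stations of c and nb c d.\<close>

datatype dir = East | West | North | South

type_synonym cell = "int \<times> int"
type_synonym user = "cell \<times> dir"

fun nb :: "cell \<Rightarrow> dir \<Rightarrow> cell" where
  "nb (i, j) East  = (i + 1, j)"
| "nb (i, j) West  = (i - 1, j)"
| "nb (i, j) North = (i, j + 1)"
| "nb (i, j) South = (i, j - 1)"

definition hears :: "user \<Rightarrow> cell \<Rightarrow> bool" where
  "hears r t \<longleftrightarrow> t = fst r \<or> t = nb (fst r) (snd r)"

text \<open>Channel realizations: H r t n is the coefficient from transmitter t to receiver r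
  at channel use n. Admissible: magnitudes in [a,b] on the connected links, otherwise arbitrary.\<close>
definition admissible :: "real \<Rightarrow> real \<Rightarrow> (user \<Rightarrow> cell \<Rightarrow> nat \<Rightarrow> complex) \<Rightarrow> bool" where
  "admissible a b H \<longleftrightarrow> (\<forall>r t n. hears r t \<longrightarrow> a \<le> cmod (H r t n) \<and> cmod (H r t n) \<le> b)"

definition msgs :: "(cell \<Rightarrow> dir \<Rightarrow> nat) \<Rightarrow> cell \<Rightarrow> (dir \<Rightarrow> nat) set" where
  "msgs M c = PiE UNIV (\<lambda>d. {..<M c d})"

text \<open>Noise over a block of length N: 2N i.i.d. real N(0,1/2) components, giving
  N i.i.d. circularly symmetric complex Gaussian samples of unit variance.\<close>
definition noise_space :: "nat \<Rightarrow> (nat \<Rightarrow> real) measure" where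
  "noise_space N = PiM {..<2 * N} (\<lambda>_. density lborel (normal_density 0 (sqrt (1/2))))"

definition cnoise :: "(nat \<Rightarrow> real) \<Rightarrow> nat \<Rightarrow> complex" where
  "cnoise g n = Complex (g (2 * n)) (g (2 * n + 1))"

definition received ::
  "nat \<Rightarrow> (user \<Rightarrow> cell \<Rightarrow> nat \<Rightarrow> complex) \<Rightarrow> cell \<Rightarrow> dir \<Rightarrow> (nat \<Rightarrow> complex) \<Rightarrow> (nat \<Rightarrow> complex)
     \<Rightarrow> (nat \<Rightarrow> real) \<Rightarrow> nat \<Rightarrow> complex" where
  "received N H c d x x' g = (\<lambda>n. if n < N
      then H (c, d) c n * x n + H (c, d) (nb c d) n * x' n + cnoise g n else 0)"

definition csir :: "nat \<Rightarrow> (user \<Rightarrow> cell \<Rightarrow> nat \<Rightarrow> complex) \<Rightarrow> user \<Rightarrow> cell \<Rightarrow> nat \<Rightarrow> complex" where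
  "csir N H r t = (\<lambda>n. if n < N then H r t n else 0)"

definition err_event where
  "err_event N H enc dec c d w w' =
     {g \<in> space (noise_space N).
        dec (c, d) (csir N H (c, d) c) (csir N H (c, d) (nb c d))
            (received N H c d (enc c w) (enc (nb c d) w') g) \<noteq> w d}"

definition err_prob where
  "err_prob N M H enc dec c d =
     (\<Sum>w\<in>msgs M c. \<Sum>w'\<in>msgs M (nb c d).
        measure (noise_space N) (err_event N H enc dec c d w w'))
     / (real (card (msgs M c)) * real (card (msgs M (nb c d))))"

text \<open>Symmetric per-cell rate R (nats per channel use) is achievable at power P for
  channel magnitude interval [a,b]: for every eps > 0 there is a block length N,
  message sizes M, encoders enc c (depending only on cell c's messages: no CSIT) meeting
  E|X_t(n)|^2 \<le> P at every channel use, each cell's sum rate \<ge> R - eps, and decoders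
  (using only the receiver's own received signal and its own channels) such that for
  every admissible channel realization every message has error probability \<le> eps.\<close>
definition achievable :: "real \<Rightarrow> real \<Rightarrow> real \<Rightarrow> real \<Rightarrow> bool" where
  "achievable a b P R \<longleftrightarrow>
    (\<forall>\<epsilon>>0. \<exists>N::nat. \<exists>M :: cell \<Rightarrow> dir \<Rightarrow> nat.
       \<exists>enc :: cell \<Rightarrow> (dir \<Rightarrow> nat) \<Rightarrow> nat \<Rightarrow> complex.
       \<exists>dec :: user \<Rightarrow> (nat \<Rightarrow> complex) \<Rightarrow> (nat \<Rightarrow> complex) \<Rightarrow> (nat \<Rightarrow> complex) \<Rightarrow> nat.
         N > 0 \<and>
         (\<forall>c d. M c d \<ge> 1) \<and>
         (\<forall>c. (\<Sum>d\<in>{East, West, North, South}. ln (real (M c d)) / real N) \<ge> R - \<epsilon>) \<and>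
         (\<forall>c. \<forall>n<N. (\<Sum>w\<in>msgs M c. (cmod (enc c w n))\<^sup>2) \<le> P * real (card (msgs M c))) \<and>
         (\<forall>H. admissible a b H \<longrightarrow>
            (\<forall>c d. (\<forall>w\<in>msgs M c. \<forall>w'\<in>msgs M (nb c d).
                      err_event N H enc dec c d w w' \<in> sets (noise_space N)) \<and>
                   err_prob N M H enc dec c d \<le> \<epsilon>)))"

definition sym_capacity :: "real \<Rightarrow> real \<Rightarrow> real \<Rightarrow> real" where
  "sym_capacity a b P = Sup {R. achievable a b P R}"

end

theory Submission
  imports Defs "HOL-Real_Asymp.Real_Asymp"
begin

text \<open>
  Achievability: colour cell (i,j) by i + 2j mod 5 and, in slot k, silence the cells of
  colour k. A cell and its four neighbours carry all five colours, so each active cell has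
  exactly one silent neighbour and serves the user on that boundary free of interference.
  Every message thus owns one fifth of the time of a point-to-point channel, on which a greedily
  chosen code over a square integer grid with minimum-distance decoding attains the cutoff rate,
  ln P up to a constant. Its error bound involves only the lower bound on the channel
  magnitudes, hence holds for all admissible channels at once.

  Converse: let all coefficients equal a. The user (e,d) decodes its own message. Told the other
  three messages of e, it subtracts the signal of e and is left with the signal of c = nb e d
  in noise; adding fixed good codewords for the neighbours of c it imitates all users of c. So
  the five rates R(e,d) and R(c,.) sum to at most ln P up to a constant, that is
  R(e,d) <= ln P - R, where R is the common cell rate. Summing over d gives R <= 4 (ln P - R).
\<close>

subsection \<open>Gaussian noise\<close>

abbreviation gauss :: "real \<Rightarrow> real measure" where
  "gauss \<sigma> \<equiv> density lborel (\<lambda>x. ennreal (normal_density 0 \<sigma> x))"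

lemma prob_space_gauss: "0 < \<sigma> \<Longrightarrow> prob_space (gauss \<sigma>)"
  by (rule prob_space_normal_density)

lemma product_prob_space_gauss: "0 < \<sigma> \<Longrightarrow> product_prob_space (\<lambda>_. gauss \<sigma>)"
  by (simp add: product_prob_space_def product_prob_space_axioms_def product_sigma_finite_def
      prob_space_gauss prob_space_imp_sigma_finite)

lemma noise_space_eq: "noise_space N = PiM {..<2 * N} (\<lambda>_. gauss (sqrt (1/2)))"
  by (simp add: noise_space_def)

lemma prob_space_noise: "prob_space (noise_space N)"
  unfolding noise_space_eq by (intro prob_space_PiM prob_space_gauss) auto

lemma space_noise: "space (noise_space N) = PiE {..<2 * N} (\<lambda>_. UNIV)"
  by (simp add: noise_space_def space_PiM)

text \<open>Completing the square turns the tilted density into a normal density centred at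
  \<open>v / 2\<close>, which has mass 1.\<close>

lemma nn_integral_gauss_exp:
  "(\<integral>\<^sup>+ x. ennreal (exp (v * x)) \<partial>gauss (sqrt (1/2))) = ennreal (exp (v\<^sup>2 / 4))"
proof -
  have *: "normal_density 0 (sqrt (1/2)) x * exp (v * x)
      = exp (v\<^sup>2 / 4) * normal_density (v / 2) (sqrt (1/2)) x" for x
  proof -
    have "- x\<^sup>2 + v * x = v\<^sup>2 / 4 - (x - v / 2)\<^sup>2"
      by (simp add: power2_eq_square field_simps)
    then show ?thesis
      by (simp add: normal_density_def exp_add[symmetric] mult.assoc)
  qed
  have "(\<integral>\<^sup>+ x. ennreal (exp (v * x)) \<partial>gauss (sqrt (1/2)))
      = (\<integral>\<^sup>+ x. ennreal (normal_density 0 (sqrt (1/2)) x) * ennreal (exp (v * x)) \<partial>lborel)"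
    by (subst nn_integral_density) auto
  also have "\<dots> = (\<integral>\<^sup>+ x. ennreal (exp (v\<^sup>2 / 4)) * ennreal (normal_density (v / 2) (sqrt (1/2)) x) \<partial>lborel)"
    by (intro nn_integral_cong) (simp add: ennreal_mult'[symmetric] *)
  also have "\<dots> = ennreal (exp (v\<^sup>2 / 4)) * (\<integral>\<^sup>+ x. ennreal (normal_density (v / 2) (sqrt (1/2)) x) \<partial>lborel)"
    by (rule nn_integral_cmult) auto
  also have "(\<integral>\<^sup>+ x. ennreal (normal_density (v / 2) (sqrt (1/2)) x) \<partial>lborel) = 1"
    by (subst nn_integral_eq_integral) auto
  finally show ?thesis by simp
qed

text \<open>On \<open>A\<close> the tilt exp(sum v g - sum v^2 / 2) is at least 1, while its mean is
  exp(- sum v^2 / 4) by the exponential moments. If \<open>A\<close> is not measurable, its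
  \<open>measure\<close> is 0 and the bound is trivial.\<close>

lemma gauss_chernoff:
  assumes A: "A \<subseteq> space (noise_space N)"
    and le: "\<And>g. g \<in> A \<Longrightarrow> (\<Sum>i<2*N. (v i)\<^sup>2) \<le> 2 * (\<Sum>i<2*N. v i * g i)"
  shows "measure (noise_space N) A \<le> exp (- (\<Sum>i<2*N. (v i)\<^sup>2) / 4)"
proof (cases "A \<in> sets (noise_space N)")
  case False
  then show ?thesis by (simp add: measure_notin_sets)
next
  case True
  interpret product_prob_space "\<lambda>_::nat. gauss (sqrt (1/2))"
    by (rule product_prob_space_gauss) auto
  let ?V = "\<Sum>i<2*N. (v i)\<^sup>2"
  have "emeasure (noise_space N) A = (\<integral>\<^sup>+ g. indicator A g \<partial>noise_space N)"
    using True by simp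
  also have "\<dots> \<le> (\<integral>\<^sup>+ g. ennreal (exp (- ?V / 2)) * (\<Prod>i<2*N. ennreal (exp (v i * g i))) \<partial>noise_space N)"
  proof (intro nn_integral_mono)
    fix g
    show "indicator A g \<le> ennreal (exp (- ?V / 2)) * (\<Prod>i<2*N. ennreal (exp (v i * g i)))"
    proof (cases "g \<in> A")
      case True
      have "exp (- ?V / 2) * (\<Prod>i<2*N. exp (v i * g i)) = exp (- ?V / 2 + (\<Sum>i<2*N. v i * g i))"
        by (subst exp_add) (simp add: exp_sum)
      also have "\<dots> \<ge> 1" using le[OF True] by simp
      finally show ?thesis using True
        by (simp add: prod_ennreal ennreal_mult'[symmetric] prod_nonneg)
    qed simp
  qed
  also have "\<dots> = ennreal (exp (- ?V / 2)) * (\<integral>\<^sup>+ g. (\<Prod>i<2*N. ennreal (exp (v i * g i))) \<partial>noise_space N)"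
    by (intro nn_integral_cmult) (auto simp: noise_space_def)
  also have "(\<integral>\<^sup>+ g. (\<Prod>i<2*N. ennreal (exp (v i * g i))) \<partial>noise_space N)
      = (\<Prod>i<2*N. ennreal (exp ((v i)\<^sup>2 / 4)))"
    unfolding noise_space_eq
    by (subst product_nn_integral_prod) (auto simp: nn_integral_gauss_exp)
  also have "\<dots> = ennreal (exp (?V / 4))"
    by (simp add: prod_ennreal exp_sum[symmetric] sum_divide_distrib)
  also have "ennreal (exp (- ?V / 2)) * ennreal (exp (?V / 4)) = ennreal (exp (- ?V / 4))"
    by (simp add: ennreal_mult'[symmetric] exp_add[symmetric])
  finally have "emeasure (noise_space N) A \<le> ennreal (exp (- ?V / 4))" .
  then show ?thesis by (simp add: measure_def enn2real_leI)
qed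

section \<open>Comparison of shifted noise with a wider centred Gaussian law\<close>

text \<open>The exponents are compared through y^2 <= 2 (y - s)^2 + 2 s^2, which is (y - 2 s)^2 >=
  0. The factor \<open>sqrt 2 * \<sigma>\<close> is the ratio of the normalising constants.\<close>

lemma normal_density_shift_le:
  assumes "1 \<le> \<sigma>"
  shows "normal_density 0 (sqrt (1/2)) (y - s)
       \<le> sqrt 2 * \<sigma> * exp (s\<^sup>2 / \<sigma>\<^sup>2) * normal_density 0 \<sigma> y"
proof -
  have s2: "1 \<le> \<sigma>\<^sup>2" using assms by simp
  have "y\<^sup>2 \<le> 2 * (y - s)\<^sup>2 + 2 * s\<^sup>2"
    using zero_le_power2[of "y - 2 * s"]
    by (simp add: power2_eq_square algebra_simps)
  then have "y\<^sup>2 / (2 * \<sigma>\<^sup>2) \<le> (2 * (y - s)\<^sup>2 + 2 * s\<^sup>2) / (2 * \<sigma>\<^sup>2)"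
    by (intro divide_right_mono) auto
  also have "\<dots> = (y - s)\<^sup>2 / \<sigma>\<^sup>2 + s\<^sup>2 / \<sigma>\<^sup>2"
    by (simp add: add_divide_distrib)
  also have "\<dots> \<le> (y - s)\<^sup>2 + s\<^sup>2 / \<sigma>\<^sup>2"
    using mult_left_mono[OF s2, of "(y - s)\<^sup>2"] s2 by (simp add: divide_le_eq)
  finally have "exp (- (y - s)\<^sup>2) \<le> exp (s\<^sup>2 / \<sigma>\<^sup>2) * exp (- y\<^sup>2 / (2 * \<sigma>\<^sup>2))"
    by (simp add: exp_add[symmetric])
  then have "exp (- (y - s)\<^sup>2) / sqrt pi \<le> exp (s\<^sup>2 / \<sigma>\<^sup>2) * exp (- y\<^sup>2 / (2 * \<sigma>\<^sup>2)) / sqrt pi"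
    by (intro divide_right_mono) auto
  then show ?thesis
    using assms by (simp add: normal_density_def real_sqrt_mult)
qed

text \<open>Induction over the coordinates: a translation moves the shift into the density, and the
  pointwise comparison then costs one factor per coordinate.\<close>

lemma nn_integral_gauss_shift_le:
  fixes f :: "(nat \<Rightarrow> real) \<Rightarrow> ennreal"
  assumes "finite I" "1 \<le> \<sigma>"
    and "f \<in> borel_measurable (PiM I (\<lambda>_. borel))"
  shows "(\<integral>\<^sup>+ z. f z \<partial>PiM I (\<lambda>_. gauss (sqrt (1/2))))
    \<le> ennreal (\<Prod>i\<in>I. sqrt 2 * \<sigma> * exp ((s i)\<^sup>2 / \<sigma>\<^sup>2))
        * (\<integral>\<^sup>+ y. f (\<lambda>i\<in>I. y i - s i) \<partial>PiM I (\<lambda>_. gauss \<sigma>))"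
  using assms(1,3)
proof (induction I arbitrary: f rule: finite_induct)
  case empty
  then show ?case by (simp add: PiM_empty nn_integral_count_space_finite)
next
  case (insert i I)
  note [measurable] = insert.prems
  note [simp] = insert.hyps
  interpret qs: prob_space "gauss \<sigma>"
    using assms(2) by (intro prob_space_gauss) auto
  interpret p: product_prob_space "\<lambda>_::nat. gauss (sqrt (1/2))"
    by (rule product_prob_space_gauss) auto
  interpret q: product_prob_space "\<lambda>_::nat. gauss \<sigma>"
    using assms(2) by (intro product_prob_space_gauss) auto
  let ?t = "\<lambda>i. sqrt 2 * \<sigma> * exp ((s i)\<^sup>2 / \<sigma>\<^sup>2)"
  have t0: "0 \<le> ?t i" for i using assms(2) by simp
  \<comment> \<open>In \<open>h\<close> coordinate \<open>i\<close> is already integrated under the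
    wide law. The induction hypothesis is applied to \<open>h\<close>, hence the generalisation over
    \<open>f\<close>.\<close>
  define h where "h = (\<lambda>z. \<integral>\<^sup>+ x. f (z(i := x - s i)) \<partial>gauss \<sigma>)"
  have sets_gauss: "sets (PiM J (\<lambda>_. gauss \<tau>)) = sets (PiM J (\<lambda>_. borel))" for J :: "nat set" and \<tau>
    by (intro sets_PiM_cong) auto
  have upd: "(\<lambda>p. (fst p)(i := snd p - s i)) \<in> PiM I (\<lambda>_. borel) \<Otimes>\<^sub>M borel \<rightarrow>\<^sub>M PiM (insert i I) (\<lambda>_. borel)"
    by (rule measurable_fun_upd[where J=I]) auto
  have upd': "(\<lambda>p. (fst p)(i := snd p - s i)) \<in> PiM I (\<lambda>_. borel) \<Otimes>\<^sub>M gauss \<sigma> \<rightarrow>\<^sub>M PiM (insert i I) (\<lambda>_. borel)"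
    using upd by (subst measurable_cong_sets[OF sets_pair_measure_cong refl]) auto
  have h_meas: "h \<in> borel_measurable (PiM I (\<lambda>_. borel))"
    unfolding h_def
    using qs.borel_measurable_nn_integral_fst[OF measurable_compose[OF upd' insert.prems]] by simp
  have fm: "f \<in> borel_measurable (PiM (insert i I) (\<lambda>_. gauss \<tau>))" for \<tau>
    using insert.prems by (subst measurable_cong_sets[OF sets_gauss refl])
  have inner: "(\<integral>\<^sup>+ x. f (z(i := x)) \<partial>gauss (sqrt (1/2))) \<le> ennreal (?t i) * h z"
    if z: "z \<in> space (PiM I (\<lambda>_. borel))" for z
  proof -
    have fz [measurable]: "(\<lambda>x. f (z(i := x))) \<in> borel_measurable borel"
    proof -
      have "(\<lambda>x. z(i := x)) \<in> borel \<rightarrow>\<^sub>M PiM (insert i I) (\<lambda>_. borel)"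
        by (rule measurable_fun_upd[where J=I]) (use z in auto)
      then show ?thesis by measurable
    qed
    have "(\<integral>\<^sup>+ x. f (z(i := x)) \<partial>gauss (sqrt (1/2)))
        = (\<integral>\<^sup>+ x. ennreal (normal_density 0 (sqrt (1/2)) x) * f (z(i := x)) \<partial>lborel)"
      by (subst nn_integral_density) auto
    also have "\<dots> = (\<integral>\<^sup>+ y. ennreal (normal_density 0 (sqrt (1/2)) (y - s i)) * f (z(i := y - s i)) \<partial>lborel)"
      by (subst nn_integral_real_affine[where c=1 and t="- s i"]) auto
    also have "\<dots> \<le> (\<integral>\<^sup>+ y. ennreal (?t i) * (ennreal (normal_density 0 \<sigma> y) * f (z(i := y - s i))) \<partial>lborel)"
      using t0 normal_density_shift_le[OF assms(2)]
      by (intro nn_integral_mono) (auto simp: mult.assoc[symmetric] ennreal_mult'[symmetric] intro!: mult_right_mono ennreal_leI)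
    also have "\<dots> = ennreal (?t i) * (\<integral>\<^sup>+ y. ennreal (normal_density 0 \<sigma> y) * f (z(i := y - s i)) \<partial>lborel)"
      by (rule nn_integral_cmult) auto
    also have "(\<integral>\<^sup>+ y. ennreal (normal_density 0 \<sigma> y) * f (z(i := y - s i)) \<partial>lborel) = h z"
      unfolding h_def by (subst nn_integral_density) auto
    finally show ?thesis .
  qed
  have "(\<integral>\<^sup>+ z. f z \<partial>PiM (insert i I) (\<lambda>_. gauss (sqrt (1/2))))
      = (\<integral>\<^sup>+ z. (\<integral>\<^sup>+ x. f (z(i := x)) \<partial>gauss (sqrt (1/2))) \<partial>PiM I (\<lambda>_. gauss (sqrt (1/2))))"
    using fm by (intro p.product_nn_integral_insert) auto
  also have "\<dots> \<le> (\<integral>\<^sup>+ z. ennreal (?t i) * h z \<partial>PiM I (\<lambda>_. gauss (sqrt (1/2))))"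
    by (intro nn_integral_mono inner) (simp add: space_PiM)
  also have "\<dots> = ennreal (?t i) * (\<integral>\<^sup>+ z. h z \<partial>PiM I (\<lambda>_. gauss (sqrt (1/2))))"
    using h_meas by (intro nn_integral_cmult) (subst measurable_cong_sets[OF sets_gauss refl])
  also have "\<dots> \<le> ennreal (?t i) * (ennreal (\<Prod>i\<in>I. ?t i)
        * (\<integral>\<^sup>+ y. h (\<lambda>i\<in>I. y i - s i) \<partial>PiM I (\<lambda>_. gauss \<sigma>)))"
    by (intro mult_left_mono insert.IH h_meas) auto
  also have "\<dots> = ennreal (\<Prod>i\<in>insert i I. ?t i) * (\<integral>\<^sup>+ y. h (\<lambda>i\<in>I. y i - s i) \<partial>PiM I (\<lambda>_. gauss \<sigma>))"
    unfolding prod.insert[OF insert.hyps] ennreal_mult[OF t0 prod_nonneg[OF t0]]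
    by (rule mult.assoc[symmetric])
  also have "(\<integral>\<^sup>+ y. h (\<lambda>i\<in>I. y i - s i) \<partial>PiM I (\<lambda>_. gauss \<sigma>))
      = (\<integral>\<^sup>+ y. (\<integral>\<^sup>+ x. f (\<lambda>j\<in>insert i I. (y(i := x)) j - s j) \<partial>gauss \<sigma>) \<partial>PiM I (\<lambda>_. gauss \<sigma>))"
    unfolding h_def
    by (intro nn_integral_cong arg_cong[where f=f]) (auto simp: fun_eq_iff)
  also have "\<dots> = (\<integral>\<^sup>+ y. f (\<lambda>j\<in>insert i I. y j - s j) \<partial>PiM (insert i I) (\<lambda>_. gauss \<sigma>))"
  proof (rule q.product_nn_integral_insert[symmetric])
    have "(\<lambda>y. \<lambda>j\<in>insert i I. y j - s j) \<in> PiM (insert i I) (\<lambda>_. borel) \<rightarrow>\<^sub>M PiM (insert i I) (\<lambda>_. borel)"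
      by (intro measurable_restrict) auto
    then have "(\<lambda>y. f (\<lambda>j\<in>insert i I. y j - s j)) \<in> borel_measurable (PiM (insert i I) (\<lambda>_. borel))"
      by measurable
    then show "(\<lambda>y. f (\<lambda>j\<in>insert i I. y j - s j)) \<in> borel_measurable (PiM (insert i I) (\<lambda>_. gauss \<sigma>))"
      by (subst measurable_cong_sets[OF sets_gauss refl])
  qed auto
  finally show ?case .
qed

subsection \<open>Converse\<close>

lemma UNIV_dir: "UNIV = {East, West, North, South}"
  using dir.exhaust by blast

lemma finite_dir [simp]: "finite (D :: dir set)"
proof -
  have "finite (UNIV :: dir set)" by (simp add: UNIV_dir)
  then show ?thesis by (rule finite_subset[OF subset_UNIV])
qed

lemma finite_msgs [simp]: "finite (msgs M c)"
  by (simp add: msgs_def finite_PiE)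

lemma msgs_ne: "(\<And>d. 1 \<le> M c d) \<Longrightarrow> msgs M c \<noteq> {}"
  unfolding msgs_def PiE_eq_empty_iff by (auto simp: lessThan_empty_iff Suc_le_eq)

lemma card_msgs: "card (msgs M c) = (\<Prod>d\<in>UNIV. M c d)"
  by (simp add: msgs_def card_PiE)

text \<open>Tuples are grouped by their components other than \<open>d\<close>. In the converse
  these are the side information given to the receiver; in the direct part an average over tuples
  becomes one over a single message.\<close>

lemma sum_msgs_fibre:
  "(\<Sum>w\<in>msgs M c. f w) = (\<Sum>u\<in>PiE (UNIV - {d}) (\<lambda>d. {..<M c d}). \<Sum>m<M c d. f (u(d := m)))"
proof -
  let ?U = "PiE (UNIV - {d}) (\<lambda>d. {..<M c d})"
  have "msgs M c = (\<lambda>(m, u). u(d := m)) ` ({..<M c d} \<times> ?U)"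
    using PiE_insert_eq[of d "UNIV - {d}" "\<lambda>d. {..<M c d}"] by (simp add: msgs_def insert_absorb)
  moreover have "inj_on (\<lambda>(m, u). u(d := m)) ({..<M c d} \<times> ?U)"
    by (rule inj_combinator) auto
  ultimately have "(\<Sum>w\<in>msgs M c. f w) = (\<Sum>(m, u)\<in>{..<M c d} \<times> ?U. f (u(d := m)))"
    by (simp add: sum.reindex case_prod_beta')
  also have "\<dots> = (\<Sum>u\<in>?U. \<Sum>m<M c d. f (u(d := m)))"
    by (simp add: sum.cartesian_product[symmetric] sum.swap[of _ _ ?U])
  finally show ?thesis .
qed

lemma card_msgs_fibre:
  "card (msgs M c) = card (PiE (UNIV - {d}) (\<lambda>d. {..<M c d})) * M c d"
  using sum_msgs_fibre[where f = "\<lambda>_. 1::nat" and M = M and c = c and d = d] by simp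

text \<open>The decoding regions \<open>A k + s k\<close> are compared under one Gaussian output law of
  larger variance, whose total mass is 1. Regions are described in noise coordinates, because
  measurability is only known for the error events.\<close>
lemma gaussian_packing:
  assumes K: "finite K" and \<sigma>: "1 \<le> \<sigma>"
    and A: "\<And>k. k \<in> K \<Longrightarrow> A k \<in> sets (noise_space N)"
    and disj: "\<And>k l g h. k \<in> K \<Longrightarrow> l \<in> K \<Longrightarrow> g \<in> A k \<Longrightarrow> h \<in> A l \<Longrightarrow>
        (\<And>i. i < 2 * N \<Longrightarrow> g i + s k i = h i + s l i) \<Longrightarrow> k = l"
  shows "(\<Sum>k\<in>K. measure (noise_space N) (A k) * exp (- (\<Sum>i<2*N. (s k i)\<^sup>2) / \<sigma>\<^sup>2)) \<le> (2 * \<sigma>\<^sup>2) ^ N"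
proof -
  interpret noise: prob_space "noise_space N" by (rule prob_space_noise)
  define Q where "Q = PiM {..<2*N} (\<lambda>_. gauss \<sigma>)"
  have Q: "prob_space Q"
    unfolding Q_def using \<sigma> by (intro prob_space_PiM prob_space_gauss) auto
  have sets_gauss: "sets (PiM J (\<lambda>_. gauss \<tau>)) = sets (PiM J (\<lambda>_. borel))" for J :: "nat set" and \<tau>
    by (intro sets_PiM_cong) auto
  \<comment> \<open>\<open>sh k\<close> recovers the noise from an output \<open>y\<close> as if
    \<open>k\<close> had been sent; the preimages \<open>D k\<close> below are the decoding regions
    in output space.\<close>
  define sh where "sh = (\<lambda>k y. \<lambda>i\<in>{..<2*N}. y i - s k i)"
  have sh: "sh k \<in> Q \<rightarrow>\<^sub>M noise_space N" for k
    unfolding sh_def Q_def noise_space_def by (intro measurable_restrict) measurable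
  define D where "D = (\<lambda>k. sh k -` A k \<inter> space Q)"
  have D: "D k \<in> sets Q" if "k \<in> K" for k
    unfolding D_def using measurable_sets[OF sh A[OF that]] .
  have disj_D: "disjoint_family_on D K"
    unfolding disjoint_family_on_def
  proof (intro ballI impI)
    fix k l assume kl: "k \<in> K" "l \<in> K" "k \<noteq> l"
    show "D k \<inter> D l = {}"
    proof (rule ccontr)
      assume "D k \<inter> D l \<noteq> {}"
      then obtain y where "sh k y \<in> A k" "sh l y \<in> A l" by (auto simp: D_def)
      then have "k = l"
        by (rule disj[OF kl(1,2)]) (simp add: sh_def)
      then show False using kl by simp
    qed
  qed
  define v where "v = (\<lambda>k. (\<Sum>i<2*N. (s k i)\<^sup>2) / \<sigma>\<^sup>2)"
  \<comment> \<open>The factors \<open>sqrt 2 * \<sigma>\<close> of the two real coordinates of a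
    channel use multiply to \<open>2 * \<sigma>\<^sup>2\<close>.\<close>
  have T: "(\<Prod>i<2*N. sqrt 2 * \<sigma> * exp ((s k i)\<^sup>2 / \<sigma>\<^sup>2)) = (2 * \<sigma>\<^sup>2) ^ N * exp (v k)" for k
  proof -
    have "(\<Prod>i<2*N. sqrt 2 * \<sigma> * exp ((s k i)\<^sup>2 / \<sigma>\<^sup>2)) = (sqrt 2 * \<sigma>) ^ (2 * N) * exp (v k)"
      by (simp add: prod.distrib exp_sum v_def sum_divide_distrib power_mult_distrib)
    then show ?thesis by (simp add: power_mult power_mult_distrib)
  qed
  have le: "measure (noise_space N) (A k) * exp (- v k) \<le> (2 * \<sigma>\<^sup>2) ^ N * measure Q (D k)" if k: "k \<in> K" for k
  proof -
    have "emeasure (noise_space N) (A k) = (\<integral>\<^sup>+ z. indicator (A k) z \<partial>noise_space N)"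
      using A[OF k] by simp
    also have "\<dots> \<le> ennreal ((2 * \<sigma>\<^sup>2) ^ N * exp (v k)) * (\<integral>\<^sup>+ y. indicator (A k) (sh k y) \<partial>Q)"
      unfolding noise_space_eq Q_def sh_def T[symmetric]
      using A[OF k] \<sigma>
      by (intro nn_integral_gauss_shift_le) (auto simp: noise_space_eq sets_gauss)
    also have "(\<integral>\<^sup>+ y. indicator (A k) (sh k y) \<partial>Q) = (\<integral>\<^sup>+ y. indicator (D k) y \<partial>Q)"
      by (intro nn_integral_cong) (auto simp: D_def indicator_def)
    also have "\<dots> = emeasure Q (D k)" using D[OF k] by simp
    finally have "ennreal (measure (noise_space N) (A k))
        \<le> ennreal ((2 * \<sigma>\<^sup>2) ^ N * exp (v k) * measure Q (D k))"
      using Q by (simp add: noise.emeasure_eq_measure finite_measure.emeasure_eq_measure[OF prob_space.finite_measure]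
          ennreal_mult'[symmetric])
    then have "measure (noise_space N) (A k) \<le> (2 * \<sigma>\<^sup>2) ^ N * exp (v k) * measure Q (D k)"
      by (subst (asm) ennreal_le_iff) auto
    then have "measure (noise_space N) (A k) * exp (- v k)
        \<le> (2 * \<sigma>\<^sup>2) ^ N * exp (v k) * measure Q (D k) * exp (- v k)"
      by (intro mult_right_mono) auto
    also have "\<dots> = (2 * \<sigma>\<^sup>2) ^ N * measure Q (D k)"
      by (simp add: exp_minus)
    finally show ?thesis .
  qed
  have "(\<Sum>k\<in>K. measure (noise_space N) (A k) * exp (- v k)) \<le> (\<Sum>k\<in>K. (2 * \<sigma>\<^sup>2) ^ N * measure Q (D k))"
    by (intro sum_mono le)
  also have "\<dots> = (2 * \<sigma>\<^sup>2) ^ N * measure Q (\<Union>k\<in>K. D k)"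
    using K D disj_D Q
    by (subst finite_measure.finite_measure_finite_Union[OF prob_space.finite_measure])
      (auto simp: sum_distrib_left)
  also have "\<dots> \<le> (2 * \<sigma>\<^sup>2) ^ N"
    using prob_space.prob_le_1[OF Q] by (intro mult_left_le) auto
  finally show ?thesis by (simp add: v_def)
qed

text \<open>The interleaving of real and imaginary parts matches \<open>cnoise\<close>, so adding
  \<open>coords x\<close> to the noise vector adds \<open>x\<close> to the complex noise.\<close>

definition coords :: "(nat \<Rightarrow> complex) \<Rightarrow> nat \<Rightarrow> real" where
  "coords x i = (if even i then Re (x (i div 2)) else Im (x (i div 2)))"

lemma sum_double: "(\<Sum>i<2*N. f i) = (\<Sum>n<N. f (2 * n) + f (2 * n + 1 :: nat))"
  for f :: "nat \<Rightarrow> real"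
  by (induction N) (auto simp: algebra_simps)

lemma sum_coords_sq: "(\<Sum>i<2*N. (coords x i)\<^sup>2) = (\<Sum>n<N. (cmod (x n))\<^sup>2)"
  by (simp add: sum_double coords_def cmod_power2)

lemma cnoise_add_eqI:
  assumes "\<And>i. i < 2 * N \<Longrightarrow> g i + coords x i = h i + coords y i" "n < N"
  shows "cnoise g n + x n = cnoise h n + y n"
  using assms(1)[of "2 * n"] assms(1)[of "2 * n + 1"] assms(2)
  by (simp add: complex_eq_iff cnoise_def coords_def)

section \<open>From packing to a rate bound for one boundary\<close>

lemma exists_le_average:
  fixes f :: "'a \<Rightarrow> real"
  assumes "finite X" "X \<noteq> {}" "(\<Sum>x\<in>X. f x) \<le> r * real (card X)"
  shows "\<exists>x\<in>X. f x \<le> r"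
proof (rule ccontr)
  assume "\<not> ?thesis"
  then have "(\<Sum>x\<in>X. r) < (\<Sum>x\<in>X. f x)"
    using assms by (intro sum_strict_mono) auto
  then show False using assms(3) by (simp add: mult.commute)
qed

text \<open>A lower bound that is linear in the error probability \<open>q\<close> and the energy \<open>v\<close>,
  so that it can be averaged over messages.\<close>
lemma weighted_success_bound:
  fixes N p q v :: real
  assumes "0 < N" "0 \<le> p" "1 - q \<le> p" "0 \<le> q" "0 \<le> v"
  shows "exp (- 4 * N) * (1 - q - v / (4 * N)) \<le> p * exp (- v)"
\<comment> \<open>Up to energy \<open>4 * N\<close> the factor \<open>exp (- v)\<close> is at least
  \<open>exp (- 4 * N)\<close>; beyond it the left-hand side is not positive.\<close>
proof (cases "v \<le> 4 * N")
  case True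
  have "1 - q - v / (4 * N) \<le> p"
    using assms by (smt (verit) divide_nonneg_pos)
  then have "exp (- 4 * N) * (1 - q - v / (4 * N)) \<le> exp (- 4 * N) * p"
    by (intro mult_left_mono) auto
  also have "\<dots> \<le> exp (- v) * p"
    using True assms by (intro mult_right_mono) auto
  finally show ?thesis by (simp add: mult.commute)
next
  case False
  then have "1 \<le> v / (4 * N)"
    using assms by (simp add: pos_le_divide_eq)
  then have "1 - q - v / (4 * N) \<le> 0"
    using assms by linarith
  then have "exp (- 4 * N) * (1 - q - v / (4 * N)) \<le> 0"
    by (simp add: mult_le_0_iff)
  also have "\<dots> \<le> p * exp (- v)" using assms by simp
  finally show ?thesis .
qed

text \<open>With all coefficients equal to \<open>a\<close>, the signal of \<open>nb e d\<close>
  reaches the user \<open>(e, d)\<close> just as it reaches its own users. One output therefore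
  determines message \<open>d\<close> of \<open>e\<close> and, given the other three messages of
  \<open>e\<close>, all messages of \<open>nb e d\<close>; packing bounds the number of such
  combinations.\<close>

lemma edge_rate_bound:
  assumes a: "0 < a" and P: "1 \<le> 4 * a\<^sup>2 * P" and N: "0 < N"
    and M: "\<And>c d. 1 \<le> M c d"
    and power: "\<And>c n. n < N \<Longrightarrow> (\<Sum>w\<in>msgs M c. (cmod (enc c w n))\<^sup>2) \<le> P * real (card (msgs M c))"
    and H: "H = (\<lambda>_ _ _. complex_of_real a)"
    and meas: "\<And>c d w w'. w \<in> msgs M c \<Longrightarrow> w' \<in> msgs M (nb c d) \<Longrightarrow>
        err_event N H enc dec c d w w' \<in> sets (noise_space N)"
    and err: "\<And>c d. err_prob N M H enc dec c d \<le> 1 / 20"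
  shows "real (M e d) * real (card (msgs M (nb e d))) \<le> 2 * exp (4 * real N) * (8 * a\<^sup>2 * P) ^ N"
proof -
  interpret noise: prob_space "noise_space N" by (rule prob_space_noise)
  define c where "c = nb e d"
  \<comment> \<open>By |x + y|^2 <= 2 |x|^2 + 2 |y|^2, the mean received signal energy per channel
    use is at most \<open>4 * a\<^sup>2 * P\<close>. With this variance the normalised energy
    \<open>v\<close> has mean at most \<open>N\<close>.\<close>
  define \<sigma> where "\<sigma> = sqrt (4 * a\<^sup>2 * P)"
  have "0 \<le> 4 * a\<^sup>2 * P" using P by linarith
  then have \<sigma>: "1 \<le> \<sigma>" "\<sigma>\<^sup>2 = 4 * a\<^sup>2 * P"
    using P unfolding \<sigma>_def by (simp_all only: real_sqrt_ge_one real_sqrt_pow2)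
  let ?p = "\<lambda>c d w w'. measure (noise_space N) (err_event N H enc dec c d w w')"
  have card_pos: "0 < card (msgs M c0)" for c0
    using msgs_ne[OF M] by (simp add: card_gt_0_iff)
  have err_sum: "(\<Sum>w\<in>msgs M c0. \<Sum>w'\<in>msgs M (nb c0 d0). ?p c0 d0 w w')
      \<le> real (card (msgs M c0)) * real (card (msgs M (nb c0 d0))) / 20" for c0 d0
    using err[of c0 d0] card_pos[of c0] card_pos[of "nb c0 d0"]
    by (simp add: err_prob_def divide_le_eq)
  \<comment> \<open>Error probabilities average over the interfering messages, so some fixed choice
    in each neighbour of \<open>c\<close> is no worse than the average. The neighbour
    \<open>e\<close> also gets such a fixed word, to replace its true signal.\<close>
  have "\<exists>w''\<in>msgs M (nb c d2). (\<Sum>w\<in>msgs M c. ?p c d2 w w'') \<le> real (card (msgs M c)) / 20" for d2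
  proof (rule exists_le_average)
    show "(\<Sum>w''\<in>msgs M (nb c d2). \<Sum>w\<in>msgs M c. ?p c d2 w w'')
        \<le> real (card (msgs M c)) / 20 * real (card (msgs M (nb c d2)))"
      using err_sum[of c d2] by (subst sum.swap) simp
  qed (use msgs_ne[OF M] in auto)
  then obtain W where W: "\<And>d2. W d2 \<in> msgs M (nb c d2)"
    and W_err: "\<And>d2. (\<Sum>w\<in>msgs M c. ?p c d2 w (W d2)) \<le> real (card (msgs M c)) / 20"
    by metis
  define q where "q = (\<lambda>w' w. ?p e d w' w + (\<Sum>d2\<in>UNIV. ?p c d2 w (W d2)))"
  define X where "X = (\<lambda>w' w n. complex_of_real a * enc e w' n + complex_of_real a * enc c w n)"
  define v where "v = (\<lambda>w' w. (\<Sum>n<N. (cmod (X w' w n))\<^sup>2) / \<sigma>\<^sup>2)"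
  define U where "U = PiE (UNIV - {d}) (\<lambda>d. {..<M e d})"
  have upd: "u(d := m) \<in> msgs M e" if "u \<in> U" "m < M e d" for u m
    using that unfolding U_def msgs_def by (auto simp: PiE_iff)
  \<comment> \<open>The noise vectors for which \<open>(e, d)\<close> and all four users of
    \<open>c\<close> decode correctly. All five decoders see the same noise; \<open>q\<close> bounds
    the loss by the union bound.\<close>
  define A where "A = (\<lambda>w' w. space (noise_space N)
      - (err_event N H enc dec e d w' w \<union> (\<Union>d2\<in>UNIV. err_event N H enc dec c d2 w (W d2))))"
  have A_sets: "A w' w \<in> sets (noise_space N)" if "w' \<in> msgs M e" "w \<in> msgs M c" for w' w
    unfolding A_def using that meas W
    by (intro sets.compl_sets sets.Un sets.finite_UN) (auto simp: c_def)
  have A_meas: "1 - q w' w \<le> measure (noise_space N) (A w' w)"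
    if "w' \<in> msgs M e" "w \<in> msgs M c" for w' w
  proof -
    have 1: "err_event N H enc dec e d w' w \<in> sets (noise_space N)"
      using meas that by (auto simp: c_def)
    have 2: "err_event N H enc dec c d2 w (W d2) \<in> sets (noise_space N)" for d2
      using meas that W by auto
    have "measure (noise_space N) (err_event N H enc dec e d w' w \<union> (\<Union>d2\<in>UNIV. err_event N H enc dec c d2 w (W d2)))
       \<le> ?p e d w' w + measure (noise_space N) (\<Union>d2\<in>UNIV. err_event N H enc dec c d2 w (W d2))"
      using 1 2 by (intro measure_Un_le) auto
    also have "measure (noise_space N) (\<Union>d2\<in>UNIV. err_event N H enc dec c d2 w (W d2))
       \<le> (\<Sum>d2\<in>UNIV. ?p c d2 w (W d2))"
      using 2 by (intro measure_UNION_le) auto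
    finally have "measure (noise_space N) (err_event N H enc dec e d w' w \<union> (\<Union>d2\<in>UNIV. err_event N H enc dec c d2 w (W d2)))
        \<le> q w' w"
      by (simp add: q_def)
    moreover have "err_event N H enc dec e d w' w \<union> (\<Union>d2\<in>UNIV. err_event N H enc dec c d2 w (W d2)) \<in> sets (noise_space N)"
      using 1 2 by (intro sets.Un sets.finite_UN) auto
    ultimately show ?thesis
      unfolding A_def by (subst noise.prob_compl) auto
  qed
  have decode: "m = m' \<and> w = w'"
    if u: "u \<in> U" and m: "m < M e d" "m' < M e d" and w: "w \<in> msgs M c" "w' \<in> msgs M c"
      and g: "g \<in> A (u(d := m)) w" and h: "h \<in> A (u(d := m')) w'"
      and eq: "\<And>i. i < 2 * N \<Longrightarrow> g i + coords (X (u(d := m)) w) i = h i + coords (X (u(d := m')) w') i"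
    for u m m' w w' g h
  proof
    have eq_n: "cnoise g n + X (u(d := m)) w n = cnoise h n + X (u(d := m')) w' n" if "n < N" for n
      using eq that by (rule cnoise_add_eqI)
    have "received N H e d (enc e (u(d := m))) (enc (nb e d) w) g
        = received N H e d (enc e (u(d := m'))) (enc (nb e d) w') h"
      using eq_n by (auto simp: received_def H X_def c_def fun_eq_iff algebra_simps)
    then show m_eq: "m = m'"
      using g h by (auto simp: A_def err_event_def c_def)
    show "w = w'"
    proof
      fix d2
      \<comment> \<open>Once \<open>m = m'\<close>, both sides contain the same signal of
        \<open>e\<close>. Cancelling it and adding the fixed word \<open>W d2\<close> gives equal
        inputs to the decoder of \<open>(c, d2)\<close>.\<close>
      have "received N H c d2 (enc c w) (enc (nb c d2) (W d2)) g
          = received N H c d2 (enc c w') (enc (nb c d2) (W d2)) h"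
        using eq_n unfolding m_eq by (auto simp: received_def H X_def fun_eq_iff algebra_simps)
      moreover have "g \<in> space (noise_space N) - err_event N H enc dec c d2 w (W d2)"
        "h \<in> space (noise_space N) - err_event N H enc dec c d2 w' (W d2)"
        using g h by (auto simp: A_def)
      ultimately show "w d2 = w' d2" by (simp add: err_event_def)
    qed
  qed
  \<comment> \<open>For fixed side information \<open>u\<close> the pairs of \<open>m\<close> and
    \<open>w\<close> index disjoint regions. The factor \<open>exp (4 * real N)\<close> is the price
    of making the bound linear in \<open>q\<close> and \<open>v\<close>, so that it can be summed
    over \<open>u\<close>.\<close>
  have packing: "(\<Sum>m<M e d. \<Sum>w\<in>msgs M c. 1 - q (u(d := m)) w - v (u(d := m)) w / (4 * real N))
      \<le> exp (4 * real N) * (2 * \<sigma>\<^sup>2) ^ N" if u: "u \<in> U" for u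
  proof -
    let ?K = "{..<M e d} \<times> msgs M c"
    let ?A = "\<lambda>k. A (u(d := fst k)) (snd k)" and ?s = "\<lambda>k. coords (X (u(d := fst k)) (snd k))"
    have "exp (- 4 * real N) * (\<Sum>m<M e d. \<Sum>w\<in>msgs M c. 1 - q (u(d := m)) w - v (u(d := m)) w / (4 * real N))
      = (\<Sum>k\<in>?K. exp (- 4 * real N) * (1 - q (u(d := fst k)) (snd k) - v (u(d := fst k)) (snd k) / (4 * real N)))"
      by (simp add: sum_distrib_left sum.cartesian_product case_prod_beta')
    also have "\<dots> \<le> (\<Sum>k\<in>?K. measure (noise_space N) (?A k) * exp (- v (u(d := fst k)) (snd k)))"
      using N A_meas upd[OF u]
      by (intro sum_mono weighted_success_bound) (auto simp: q_def v_def intro!: add_nonneg_nonneg sum_nonneg divide_nonneg_nonneg)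
    also have "\<dots> = (\<Sum>k\<in>?K. measure (noise_space N) (?A k) * exp (- (\<Sum>i<2*N. (?s k i)\<^sup>2) / \<sigma>\<^sup>2))"
      by (simp add: sum_coords_sq v_def)
    also have "\<dots> \<le> (2 * \<sigma>\<^sup>2) ^ N"
    proof (rule gaussian_packing)
      fix k assume "k \<in> ?K"
      then show "?A k \<in> sets (noise_space N)" using A_sets upd[OF u] by auto
    next
      fix k l g h
      assume "k \<in> ?K" "l \<in> ?K" "g \<in> ?A k" "h \<in> ?A l"
        "\<And>i. i < 2 * N \<Longrightarrow> g i + ?s k i = h i + ?s l i"
      then show "k = l"
        using decode[OF u, of "fst k" "fst l" "snd k" "snd l" g h] by (auto simp: prod_eq_iff)
    qed (use \<sigma> in auto)
    finally have "exp (4 * real N) * (exp (- 4 * real N) * (\<Sum>m<M e d. \<Sum>w\<in>msgs M c. 1 - q (u(d := m)) w - v (u(d := m)) w / (4 * real N)))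
      \<le> exp (4 * real N) * (2 * \<sigma>\<^sup>2) ^ N"
      by (intro mult_left_mono) auto
    then show ?thesis by (simp add: mult.assoc[symmetric] exp_add[symmetric])
  qed
  let ?E = "real (card (msgs M e))" and ?C = "real (card (msgs M c))"
  have "(\<Sum>w'\<in>msgs M e. \<Sum>w\<in>msgs M c. 1 - q w' w - v w' w / (4 * real N))
      \<le> (\<Sum>u\<in>U. exp (4 * real N) * (2 * \<sigma>\<^sup>2) ^ N)"
    unfolding sum_msgs_fibre[where M = M and c = e and d = d] U_def[symmetric]
    by (intro sum_mono packing)
  then have upper: "(\<Sum>w'\<in>msgs M e. \<Sum>w\<in>msgs M c. 1 - q w' w - v w' w / (4 * real N))
      \<le> real (card U) * (exp (4 * real N) * (2 * \<sigma>\<^sup>2) ^ N)"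
    by simp
  \<comment> \<open>Five error terms of average at most 1/20 each: one for \<open>(e, d)\<close> and
    four for the users of \<open>c\<close>.\<close>
  have q_sum: "(\<Sum>w'\<in>msgs M e. \<Sum>w\<in>msgs M c. q w' w) \<le> ?E * ?C / 4"
  proof -
    have "(\<Sum>w'\<in>msgs M e. \<Sum>w\<in>msgs M c. q w' w)
        = (\<Sum>w'\<in>msgs M e. \<Sum>w\<in>msgs M c. ?p e d w' w)
          + ?E * (\<Sum>d2\<in>UNIV. \<Sum>w\<in>msgs M c. ?p c d2 w (W d2))"
      unfolding q_def by (subst sum.swap[of _ _ UNIV]) (simp add: sum.distrib)
    also have "\<dots> \<le> ?E * ?C / 20 + ?E * (\<Sum>d2\<in>(UNIV :: dir set). ?C / 20)"
      using err_sum[of e d] W_err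
      by (intro add_mono mult_left_mono sum_mono) (auto simp: c_def)
    also have "\<dots> = ?E * ?C / 4" by (simp add: UNIV_dir)
    finally show ?thesis .
  qed
  have v_sum: "(\<Sum>w'\<in>msgs M e. \<Sum>w\<in>msgs M c. v w' w) \<le> real N * (?E * ?C)"
  proof -
    have pt: "(cmod (X w' w n))\<^sup>2 \<le> 2 * a\<^sup>2 * ((cmod (enc e w' n))\<^sup>2 + (cmod (enc c w n))\<^sup>2)" for w' w n
    proof -
      let ?x = "cmod (enc e w' n)" and ?y = "cmod (enc c w n)"
      have "cmod (X w' w n) \<le> a * ?x + a * ?y"
        unfolding X_def using norm_triangle_ineq[of "complex_of_real a * enc e w' n" "complex_of_real a * enc c w n"] a
        by (simp add: norm_mult)
      then have "(cmod (X w' w n))\<^sup>2 \<le> (a * ?x + a * ?y)\<^sup>2"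
        by (intro power_mono) auto
      also have "\<dots> = a\<^sup>2 * (?x + ?y)\<^sup>2" by (simp add: power2_eq_square algebra_simps)
      also have "\<dots> \<le> a\<^sup>2 * (2 * (?x\<^sup>2 + ?y\<^sup>2))"
        using sum_squares_bound[of ?x ?y] by (intro mult_left_mono) (auto simp: power2_sum)
      finally show ?thesis by (simp only: mult_ac)
    qed
    have "(\<Sum>w'\<in>msgs M e. \<Sum>w\<in>msgs M c. v w' w) * \<sigma>\<^sup>2
        = (\<Sum>n<N. \<Sum>w'\<in>msgs M e. \<Sum>w\<in>msgs M c. (cmod (X w' w n))\<^sup>2)"
    proof -
      have "(\<Sum>w'\<in>msgs M e. \<Sum>w\<in>msgs M c. v w' w) * \<sigma>\<^sup>2
          = (\<Sum>w'\<in>msgs M e. \<Sum>w\<in>msgs M c. \<Sum>n<N. (cmod (X w' w n))\<^sup>2)"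
      proof -
        have "v w' w * \<sigma>\<^sup>2 = (\<Sum>n<N. (cmod (X w' w n))\<^sup>2)" for w' w
          using \<sigma>(1) by (simp add: v_def)
        then show ?thesis by (simp add: sum_distrib_right)
      qed
      also have "\<dots> = (\<Sum>w'\<in>msgs M e. \<Sum>n<N. \<Sum>w\<in>msgs M c. (cmod (X w' w n))\<^sup>2)"
        by (intro sum.cong refl sum.swap)
      also have "\<dots> = (\<Sum>n<N. \<Sum>w'\<in>msgs M e. \<Sum>w\<in>msgs M c. (cmod (X w' w n))\<^sup>2)"
        by (rule sum.swap)
      finally show ?thesis .
    qed
    also have "\<dots> \<le> (\<Sum>n<N. 2 * a\<^sup>2 * (2 * P * (?E * ?C)))"
    proof (intro sum_mono)
      fix n assume "n \<in> {..<N}"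
      then have n: "n < N" by simp
      have "(\<Sum>w'\<in>msgs M e. \<Sum>w\<in>msgs M c. (cmod (X w' w n))\<^sup>2)
          \<le> (\<Sum>w'\<in>msgs M e. \<Sum>w\<in>msgs M c. 2 * a\<^sup>2 * ((cmod (enc e w' n))\<^sup>2 + (cmod (enc c w n))\<^sup>2))"
        by (intro sum_mono pt)
      also have "\<dots> = 2 * a\<^sup>2 * (?C * (\<Sum>w'\<in>msgs M e. (cmod (enc e w' n))\<^sup>2)
          + ?E * (\<Sum>w\<in>msgs M c. (cmod (enc c w n))\<^sup>2))"
        by (simp add: sum_distrib_left[symmetric] sum.distrib)
      also have "\<dots> \<le> 2 * a\<^sup>2 * (?C * (P * ?E) + ?E * (P * ?C))"
        using power[OF n] by (intro mult_left_mono add_mono) auto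
      finally show "(\<Sum>w'\<in>msgs M e. \<Sum>w\<in>msgs M c. (cmod (X w' w n))\<^sup>2) \<le> 2 * a\<^sup>2 * (2 * P * (?E * ?C))"
        by (simp add: algebra_simps)
    qed
    also have "\<dots> = real N * (?E * ?C) * \<sigma>\<^sup>2" by (simp add: \<sigma>(2))
    finally show ?thesis using \<sigma>(1) by simp
  qed
  \<comment> \<open>Errors cost a quarter and energy another quarter, since the mean of
    \<open>v\<close> is at most \<open>N\<close>. The remaining half produces the factor 2 in the
    conclusion.\<close>
  have "?E * ?C / 2 \<le> ?E * ?C - ?E * ?C / 4 - real N * (?E * ?C) / (4 * real N)"
    using N by simp
  also have "\<dots> \<le> ?E * ?C - (\<Sum>w'\<in>msgs M e. \<Sum>w\<in>msgs M c. q w' w)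
      - (\<Sum>w'\<in>msgs M e. \<Sum>w\<in>msgs M c. v w' w) / (4 * real N)"
    using q_sum v_sum by (intro diff_mono divide_right_mono order_refl) auto
  also have "\<dots> = (\<Sum>w'\<in>msgs M e. \<Sum>w\<in>msgs M c. 1 - q w' w - v w' w / (4 * real N))"
    by (simp add: sum_subtractf sum_divide_distrib)
  also note upper
  finally have "real (card U) * (real (M e d) * ?C) \<le> real (card U) * (2 * exp (4 * real N) * (2 * \<sigma>\<^sup>2) ^ N)"
    by (simp add: card_msgs_fibre[of M e d] U_def mult.assoc)
  moreover have "0 < card U"
    using card_pos[of e] card_msgs_fibre[of M e d] by (auto simp: U_def intro: Nat.gr0I)
  ultimately have "real (M e d) * ?C \<le> 2 * exp (4 * real N) * (2 * \<sigma>\<^sup>2) ^ N"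
    by (subst (asm) mult_le_cancel_left_pos) auto
  moreover have "2 * \<sigma>\<^sup>2 = 8 * a\<^sup>2 * P" by (simp add: \<sigma>(2))
  ultimately show ?thesis by (simp only: c_def)
qed

text \<open>The single choice 1/20 serves both as error level for \<open>edge_rate_bound\<close> and
  as rate slack. A fixed slack suffices, since additive constants disappear after division by
  \<open>ln P\<close>.\<close>

lemma achievable_upper:
  assumes a: "0 < a" "a \<le> b" and P: "1 \<le> 4 * a\<^sup>2 * P" and ach: "achievable a b P R"
  shows "R \<le> 4 / 5 * (ln P + ln (8 * a\<^sup>2) + 4 + ln 2) + 1 / 20"
proof -
  define H :: "user \<Rightarrow> cell \<Rightarrow> nat \<Rightarrow> complex" where "H = (\<lambda>_ _ _. complex_of_real a)"
  have H: "admissible a b H" using a by (simp add: admissible_def H_def)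
  have Ppos: "0 < P"
  proof (rule ccontr)
    assume "\<not> 0 < P"
    then have "4 * a\<^sup>2 * P \<le> 0" by (intro mult_nonneg_nonpos) auto
    then show False using P by linarith
  qed
  have "0 < (1 / 20 :: real)" by simp
  note code = mp[OF spec[OF ach[unfolded achievable_def]] this]
  obtain N M enc dec where N: "0 < N" and all_M: "\<forall>c d. 1 \<le> M c d"
    and all_rate: "\<forall>c. (\<Sum>d\<in>{East, West, North, South}. ln (real (M c d)) / real N) \<ge> R - 1 / 20"
    and all_power: "\<forall>c. \<forall>n<N. (\<Sum>w\<in>msgs M c. (cmod (enc c w n))\<^sup>2) \<le> P * real (card (msgs M c))"
    and all_dec: "\<forall>H. admissible a b H \<longrightarrow>
      (\<forall>c d. (\<forall>w\<in>msgs M c. \<forall>w'\<in>msgs M (nb c d). err_event N H enc dec c d w w' \<in> sets (noise_space N)) \<and>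
        err_prob N M H enc dec c d \<le> 1 / 20)"
    using code by (elim exE conjE) (rule that)
  note M = all_M[rule_format] and rate = all_rate[rule_format] and power = all_power[rule_format]
    and dec = all_dec[rule_format, OF H]
  define B where "B = ln P + ln (8 * a\<^sup>2) + 4 + ln 2"
  define S where "S = (\<lambda>c. \<Sum>d\<in>UNIV. ln (real (M c d)) / real N)"
  have S: "R - 1 / 20 \<le> S c" for c using rate[of c] by (simp only: S_def UNIV_dir)
  have edge: "ln (real (M e d)) / real N \<le> B - S (nb e d)" for e d
  proof -
    have "real (M e d) * real (card (msgs M (nb e d))) \<le> 2 * exp (4 * real N) * (8 * a\<^sup>2 * P) ^ N"
    proof (rule edge_rate_bound[OF a(1) P N M power H_def])
      show "err_event N H enc dec c d w w' \<in> sets (noise_space N)"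
        if "w \<in> msgs M c" "w' \<in> msgs M (nb c d)" for c d w w'
        using dec[of c d] that by blast
      show "err_prob N M H enc dec c d \<le> 1 / 20" for c d
        using dec[of c d] by blast
    qed
    moreover have "0 < real (M e d) * real (card (msgs M (nb e d)))"
      using M by (simp add: card_msgs Suc_le_eq prod_pos)
    ultimately have "ln (real (M e d) * real (card (msgs M (nb e d))))
        \<le> ln (2 * exp (4 * real N) * (8 * a\<^sup>2 * P) ^ N)"
      by (subst ln_le_cancel_iff) auto
    also have "\<dots> = ln 2 + real N * (4 + ln (8 * a\<^sup>2) + ln P)"
      using a Ppos by (simp add: ln_mult ln_realpow algebra_simps)
    \<comment> \<open>The single \<open>ln 2\<close> is bounded by \<open>real N * ln 2\<close>, as
      \<open>N\<close> is at least 1.\<close>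
    also have "\<dots> \<le> real N * B"
      using N by (simp add: B_def algebra_simps)
    also have "ln (real (M e d) * real (card (msgs M (nb e d)))) = ln (real (M e d)) + real N * S (nb e d)"
    proof -
      have pos: "0 < M c d" for c d using M[of c d] by simp
      have "ln (real (card (msgs M (nb e d)))) = real N * S (nb e d)"
        using pos N by (simp add: card_msgs ln_prod S_def sum_distrib_left)
      then show ?thesis
        using pos by (subst ln_mult) (auto simp: card_msgs prod_pos)
    qed
    finally show ?thesis using N by (simp add: field_simps)
  qed
  \<comment> \<open>One cell suffices: its four messages are bounded through its neighbours, whose
    rates are all at least \<open>R - 1 / 20\<close>.\<close>
  have "R - 1 / 20 \<le> S (0, 0)" by (rule S)
  also have "\<dots> \<le> (\<Sum>d\<in>(UNIV :: dir set). B - (R - 1 / 20))"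
    unfolding S_def
  proof (intro sum_mono)
    fix d
    show "ln (real (M (0, 0) d)) / real N \<le> B - (R - 1 / 20)"
      using edge[of "(0,0)" d] S[of "nb (0,0) d"] by linarith
  qed
  also have "\<dots> = 4 * (B - (R - 1 / 20))" by (simp add: UNIV_dir)
  finally have "5 * R \<le> 4 * B + 1 / 4" by (simp add: algebra_simps)
  then have "R \<le> 4 / 5 * B + 1 / 20" by (simp add: field_simps)
  then show ?thesis unfolding B_def .
qed

subsection \<open>Achievability\<close>

lemma sum_power_inj_le:
  fixes r :: real
  assumes "0 \<le> r" "r < 1" "finite A" "inj_on g A"
  shows "(\<Sum>y\<in>A. r ^ g y) \<le> 1 / (1 - r)"
proof -
  have "(\<Sum>y\<in>A. r ^ g y) = (\<Sum>j\<in>g ` A. r ^ j)"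
    using assms(4) by (simp add: sum.reindex)
  also have "\<dots> \<le> (\<Sum>j. r ^ j)"
    using assms by (intro sum_le_suminf) (auto intro: summable_geometric)
  also have "\<dots> = 1 / (1 - r)" using assms by (intro suminf_geometric) auto
  finally show ?thesis .
qed

text \<open>Since j <= j^2 for natural j, the kernel is dominated by a geometric sequence on either
  side of \<open>x\<close>. The bound does not depend on \<open>q\<close>, so it stays constant as
  the power grows.\<close>

lemma sum_gaussian_kernel_le:
  assumes "0 < \<beta>"
  shows "(\<Sum>y<q. exp (- \<beta> * (real x - real y)\<^sup>2)) \<le> 2 / (1 - exp (- \<beta>))"
proof -
  let ?r = "exp (- \<beta>)"
  have r: "0 \<le> ?r" "?r < 1" using assms by auto
  have le: "exp (- \<beta> * (real x - real y)\<^sup>2) \<le> ?r ^ j" if "\<bar>real x - real y\<bar> = real j" for y j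
  proof -
    have "real j \<le> (real j)\<^sup>2" by (cases j) (auto simp: power2_eq_square)
    then have "\<beta> * real j \<le> \<beta> * (real x - real y)\<^sup>2"
      using assms that[symmetric] by (intro mult_left_mono) auto
    then show ?thesis by (simp add: exp_of_nat_mult[symmetric] mult.commute)
  qed
  have "(\<Sum>y<q. exp (- \<beta> * (real x - real y)\<^sup>2))
      = (\<Sum>y\<in>{..<q} \<inter> {..x}. exp (- \<beta> * (real x - real y)\<^sup>2))
      + (\<Sum>y\<in>{..<q} - {..x}. exp (- \<beta> * (real x - real y)\<^sup>2))"
    by (rule sum.Int_Diff) auto
  also have "\<dots> \<le> (\<Sum>y\<in>{..<q} \<inter> {..x}. ?r ^ (x - y)) + (\<Sum>y\<in>{..<q} - {..x}. ?r ^ (y - x))"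
    by (intro add_mono sum_mono le) auto
  also have "\<dots> \<le> 1 / (1 - ?r) + 1 / (1 - ?r)"
    using r by (intro add_mono sum_power_inj_le) (auto simp: inj_on_def)
  finally show ?thesis by simp
qed

text \<open>Chernoff bound on the probability of confusing the codewords.\<close>
definition overlap :: "real \<Rightarrow> nat \<Rightarrow> (nat \<Rightarrow> nat) \<Rightarrow> (nat \<Rightarrow> nat) \<Rightarrow> real" where
  "overlap \<beta> n x y = exp (- \<beta> * (\<Sum>i<2*n. (real (x i) - real (y i))\<^sup>2))"

lemma overlap_commute: "overlap \<beta> n x y = overlap \<beta> n y x"
  by (simp add: overlap_def power2_commute)

text \<open>The exponential factors over the coordinates and so does the sum over the grid. Against
  the \<open>q ^ (2 * n)\<close> grid points this leaves an average overlap that decays like a power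
  of \<open>q\<close>.\<close>

lemma sum_overlap_le:
  assumes "0 < \<beta>"
  shows "(\<Sum>y\<in>PiE {..<2*n} (\<lambda>_. {..<q}). overlap \<beta> n x y) \<le> (2 / (1 - exp (- \<beta>))) ^ (2 * n)"
proof -
  have "(\<Sum>y\<in>PiE {..<2*n} (\<lambda>_. {..<q}). overlap \<beta> n x y)
     = (\<Sum>y\<in>PiE {..<2*n} (\<lambda>_. {..<q}). \<Prod>i<2*n. exp (- \<beta> * (real (x i) - real (y i))\<^sup>2))"
    by (simp add: overlap_def sum_distrib_left sum_negf[symmetric] exp_sum)
  also have "\<dots> = (\<Prod>i<2*n. \<Sum>y<q. exp (- \<beta> * (real (x i) - real y)\<^sup>2))"
    by (subst prod_sum_PiE) auto
  also have "\<dots> \<le> (\<Prod>i<2*n. 2 / (1 - exp (- \<beta>)))"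
    using sum_gaussian_kernel_le[OF assms] by (intro prod_mono) (auto intro: sum_nonneg)
  finally show ?thesis by simp
qed

text \<open>Derandomised random coding: the next codeword is chosen so that its total overlap with
  the earlier ones is at most the average over \<open>X\<close>. By symmetry it enters the double
  sum twice, and M (M - 1) + 2 M = (M + 1) M. Codewords may repeat.\<close>

lemma greedy_codebook:
  fixes \<kappa> :: "'x \<Rightarrow> 'x \<Rightarrow> real"
  assumes X: "finite X" "X \<noteq> {}"
    and sym: "\<And>x y. \<kappa> x y = \<kappa> y x"
    and B: "\<And>x. x \<in> X \<Longrightarrow> (\<Sum>y\<in>X. \<kappa> x y) \<le> B"
  shows "\<exists>f. (\<forall>i. f i \<in> X) \<and>
    (\<Sum>i<M. \<Sum>j\<in>{..<M} - {i}. \<kappa> (f i) (f j)) \<le> real M * (real M - 1) * (B / real (card X))"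
proof (induction M)
  case 0
  then show ?case using X by (auto intro!: exI[of _ "\<lambda>_. SOME x. x \<in> X"] simp: some_in_eq)
next
  case (Suc M)
  then obtain f where f: "\<And>i. f i \<in> X"
    and IH: "(\<Sum>i<M. \<Sum>j\<in>{..<M} - {i}. \<kappa> (f i) (f j)) \<le> real M * (real M - 1) * (B / real (card X))"
    by blast
  have cX: "0 < real (card X)" using X by (simp add: card_gt_0_iff)
  have "(\<Sum>y\<in>X. \<Sum>i<M. \<kappa> (f i) y) = (\<Sum>i<M. \<Sum>y\<in>X. \<kappa> (f i) y)"
    by (rule sum.swap)
  also have "\<dots> \<le> (\<Sum>i<M. B)" using f by (intro sum_mono B)
  also have "\<dots> = real M * (B / real (card X)) * real (card X)" using cX by simp
  finally obtain y where y: "y \<in> X" "(\<Sum>i<M. \<kappa> (f i) y) \<le> real M * (B / real (card X))"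
    using exists_le_average[OF X] by blast
  define g where "g = f(M := y)"
  have split: "{..<Suc M} - {i} = insert M ({..<M} - {i})" if "i < M" for i
    using that by auto
  have "(\<Sum>i<Suc M. \<Sum>j\<in>{..<Suc M} - {i}. \<kappa> (g i) (g j))
      = (\<Sum>i<M. \<Sum>j\<in>{..<Suc M} - {i}. \<kappa> (g i) (g j)) + (\<Sum>j<M. \<kappa> (g M) (g j))"
    by (simp add: lessThan_Suc)
  also have "(\<Sum>j<M. \<kappa> (g M) (g j)) = (\<Sum>j<M. \<kappa> (f j) y)"
    by (intro sum.cong) (auto simp: g_def sym[of y])
  also have "(\<Sum>i<M. \<Sum>j\<in>{..<Suc M} - {i}. \<kappa> (g i) (g j))
      = (\<Sum>i<M. \<kappa> (f i) y + (\<Sum>j\<in>{..<M} - {i}. \<kappa> (f i) (f j)))"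
    by (intro sum.cong) (auto simp: split g_def intro!: sum.cong)
  finally have "(\<Sum>i<Suc M. \<Sum>j\<in>{..<Suc M} - {i}. \<kappa> (g i) (g j))
      = (\<Sum>i<M. \<Sum>j\<in>{..<M} - {i}. \<kappa> (f i) (f j)) + 2 * (\<Sum>i<M. \<kappa> (f i) y)"
    by (simp add: sum.distrib)
  also have "\<dots> \<le> real M * (real M - 1) * (B / real (card X)) + 2 * (real M * (B / real (card X)))"
    using IH y by (intro add_mono mult_left_mono) auto
  also have "\<dots> = real (Suc M) * (real (Suc M) - 1) * (B / real (card X))"
    by (simp add: algebra_simps)
  finally show ?case using f y by (intro exI[of _ g]) (auto simp: g_def)
qed

section \<open>The time-division scheme\<close>

definition symbol :: "(nat \<Rightarrow> nat) \<Rightarrow> nat \<Rightarrow> complex" where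
  "symbol x \<tau> = Complex (real (x (2 * \<tau>))) (real (x (2 * \<tau> + 1)))"

definition silent :: "cell \<Rightarrow> nat" where
  "silent c = nat ((fst c + 2 * snd c) mod 5)"

lemma silent_less: "silent c < 5"
  by (simp add: silent_def nat_less_iff)

lemma silent_eq_iff:
  "silent c = silent c' \<longleftrightarrow> 5 dvd (fst c + 2 * snd c) - (fst c' + 2 * snd c')"
  by (simp add: silent_def mod_eq_dvd_iff[symmetric] nat_eq_iff2 eq_commute)

text \<open>The four neighbours change \<open>fst c + 2 * snd c\<close> by 1, -1, 2 and -2, which
  are nonzero and, as the next lemma needs, distinct modulo 5.\<close>

lemma silent_nb_ne: "silent (nb c d) \<noteq> silent c"
  unfolding silent_eq_iff by (cases c; cases d) simp_all

lemma silent_nb_inj: "silent (nb c d) = silent (nb c d') \<longleftrightarrow> d = d'"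
  unfolding silent_eq_iff by (cases c; cases d; cases d') simp_all

text \<open>At most one summand is nonzero: cell \<open>c\<close> serves direction \<open>d\<close> exactly when
  \<open>nb c d\<close> is silent.\<close>
definition tdma_enc :: "(nat \<Rightarrow> nat \<Rightarrow> nat) \<Rightarrow> cell \<Rightarrow> (dir \<Rightarrow> nat) \<Rightarrow> nat \<Rightarrow> complex" where
  "tdma_enc f c w t = (\<Sum>d\<in>UNIV. if t mod 5 = silent (nb c d) then symbol (f (w d)) (t div 5) else 0)"

lemma tdma_enc_active:
  assumes "t mod 5 = silent (nb c d)"
  shows "tdma_enc f c w t = symbol (f (w d)) (t div 5)"
proof -
  have "tdma_enc f c w t = (\<Sum>d'\<in>UNIV. if d' = d then symbol (f (w d')) (t div 5) else 0)"
    unfolding tdma_enc_def by (intro sum.cong) (auto simp: assms silent_nb_inj)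
  then show ?thesis by simp
qed

lemma tdma_enc_silent: "t mod 5 = silent c \<Longrightarrow> tdma_enc f c w t = 0"
  unfolding tdma_enc_def by (intro sum.neutral) (metis silent_nb_ne)

text \<open>The power bound holds for every message tuple, not just on average, because at most one
  grid point of side \<open>q\<close> is sent at a time.\<close>

lemma cmod_tdma_enc_le:
  assumes f: "\<And>m. f m \<in> PiE {..<2*n} (\<lambda>_. {..<q})" and t: "t < 5 * n" and P: "2 * (real q)\<^sup>2 \<le> P"
  shows "(cmod (tdma_enc f c w t))\<^sup>2 \<le> P"
proof (cases "\<exists>d. t mod 5 = silent (nb c d)")
  case True
  then obtain d where d: "t mod 5 = silent (nb c d)" by blast
  have lt: "f (w d) i \<le> q" if "i < 2 * n" for i
    using PiE_mem[OF f, of i "w d"] that by auto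
  have "t div 5 < n" using t by (simp add: div_less_iff_less_mult mult.commute)
  then have "(real (f (w d) (2 * (t div 5))))\<^sup>2 \<le> (real q)\<^sup>2"
    "(real (f (w d) (2 * (t div 5) + 1)))\<^sup>2 \<le> (real q)\<^sup>2"
    using lt[of "2 * (t div 5)"] lt[of "2 * (t div 5) + 1"] by (intro power_mono; simp)+
  then have "(cmod (tdma_enc f c w t))\<^sup>2 \<le> 2 * (real q)\<^sup>2"
    unfolding tdma_enc_active[OF d] symbol_def cmod_power2 complex.sel by linarith
  then show ?thesis using P by linarith
next
  case False
  then have "tdma_enc f c w t = 0" by (simp add: tdma_enc_def)
  moreover have "0 \<le> P" using P by (smt (verit) zero_le_power2)
  ultimately show ?thesis by simp
qed

definition slot_dist :: "(nat \<Rightarrow> nat \<Rightarrow> nat) \<Rightarrow> nat \<Rightarrow> nat \<Rightarrow> (nat \<Rightarrow> complex) \<Rightarrow> (nat \<Rightarrow> complex) \<Rightarrow> nat \<Rightarrow> real" where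
  "slot_dist f N s h y m =
     (\<Sum>t<N. if t mod 5 = s then (cmod (y t - h t * symbol (f m) (t div 5)))\<^sup>2 else 0)"

text \<open>Minimum-distance decoding; \<open>LEAST\<close> breaks ties and keeps the decision
  measurable.\<close>

definition tdma_dec where
  "tdma_dec f N M r h h' y =
     (LEAST m. m < M \<and> (\<forall>m'<M. slot_dist f N (silent (nb (fst r) (snd r))) h y m
        \<le> slot_dist f N (silent (nb (fst r) (snd r))) h y m'))"

lemma tdma_dec_neqD:
  assumes ne: "tdma_dec f N M r h h' y \<noteq> m" and m: "m < M"
  shows "\<exists>m'\<in>{..<M} - {m}. slot_dist f N (silent (nb (fst r) (snd r))) h y m'
      \<le> slot_dist f N (silent (nb (fst r) (snd r))) h y m"
proof -
  let ?met = "slot_dist f N (silent (nb (fst r) (snd r))) h y"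
  let ?best = "\<lambda>m. m < M \<and> (\<forall>m'<M. ?met m \<le> ?met m')"
  have "Min (?met ` {..<M}) \<in> ?met ` {..<M}"
    using m by (intro Min_in) auto
  then obtain m0 where "m0 < M" "?met m0 = Min (?met ` {..<M})"
    by (metis imageE lessThan_iff)
  then have "?best m0" by simp
  then have "?best (tdma_dec f N M r h h' y)"
    unfolding tdma_dec_def by (rule LeastI)
  then show ?thesis using ne m by blast
qed

lemma sum_slot:
  fixes F :: "nat \<Rightarrow> real"
  assumes "s < 5"
  shows "(\<Sum>t<5*n. if t mod 5 = s then F (t div 5) else 0) = (\<Sum>\<tau><n. F \<tau>)"
proof -
  have "(\<Sum>t<5*n. if t mod 5 = s then F (t div 5) else 0)
      = (\<Sum>t\<in>{t \<in> {..<5*n}. t mod 5 = s}. F (t div 5))"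
    by (rule sum.inter_filter[symmetric]) simp
  also have "\<dots> = (\<Sum>\<tau><n. F \<tau>)"
    by (rule sum.reindex_bij_witness[of _ "\<lambda>\<tau>. 5 * \<tau> + s" "\<lambda>t. t div 5"])
      (use assms in \<open>auto simp: div_less_iff_less_mult\<close>)
  finally show ?thesis .
qed

lemma measurable_cnoise [measurable]:
  assumes "t < N"
  shows "(\<lambda>g. cnoise g t) \<in> borel_measurable (noise_space N)"
proof -
  have [measurable]: "(\<lambda>g. g i) \<in> borel_measurable (noise_space N)" if "i < 2 * N" for i
    unfolding noise_space_def using that by (auto intro: measurable_component_singleton[THEN measurable_compose])
  have "2 * t < 2 * N" "2 * t + 1 < 2 * N" using assms by auto
  then have "(\<lambda>g. complex_of_real (g (2 * t)) + \<i> * complex_of_real (g (2 * t + 1))) \<in> borel_measurable (noise_space N)"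
    by measurable
  then show ?thesis by (simp add: cnoise_def Complex_eq)
qed

text \<open>The decision is a \<open>LEAST\<close> over finitely many comparisons of measurable
  distances.\<close>

lemma tdma_err_event_sets:
  "err_event N H enc (tdma_dec f N M) c d w w' \<in> sets (noise_space N)"
proof -
  define met where "met = (\<lambda>g. slot_dist f N (silent (nb c d)) (csir N H (c, d) c)
      (received N H c d (enc c w) (enc (nb c d) w') g))"
  have met: "(\<lambda>g. met g m) \<in> borel_measurable (noise_space N)" for m
    unfolding met_def slot_dist_def
  proof (intro borel_measurable_sum)
    fix t assume "t \<in> {..<N}"
    then have t: "t < N" by simp
    note [measurable] = measurable_cnoise[OF t]
    show "(\<lambda>g. if t mod 5 = silent (nb c d) then (cmod (received N H c d (enc c w) (enc (nb c d) w') g t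
        - csir N H (c, d) c t * symbol (f m) (t div 5)))\<^sup>2 else 0) \<in> borel_measurable (noise_space N)"
      using t unfolding received_def by simp
  qed
  have "{g \<in> space (noise_space N). met g m \<le> met g m'} \<in> sets (noise_space N)" for m m'
    by (rule borel_measurable_le) (rule met)+
  then have "{g \<in> space (noise_space N). m < M \<and> (\<forall>m'\<in>{..<M}. met g m \<le> met g m')} \<in> sets (noise_space N)" for m
    by (intro sets.sets_Collect_conj sets.sets_Collect_const sets.sets_Collect_finite_All) auto
  then have best: "(\<lambda>g. LEAST m. m < M \<and> (\<forall>m'<M. met g m \<le> met g m'))
      \<in> noise_space N \<rightarrow>\<^sub>M count_space UNIV"
    by (intro measurable_Least) (simp only: pred_def Ball_def lessThan_iff)
  have eq: "err_event N H enc (tdma_dec f N M) c d w w'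
      = (\<lambda>g. LEAST m. m < M \<and> (\<forall>m'<M. met g m \<le> met g m')) -` (- {w d}) \<inter> space (noise_space N)"
    unfolding err_event_def tdma_dec_def met_def fst_conv snd_conv by blast
  show ?thesis
    unfolding eq by (rule measurable_sets[OF best]) (simp only: sets_count_space Pow_UNIV UNIV_I)
qed

text \<open>Expanding the square turns a comparison of distances into the linear condition of
  \<open>gauss_chernoff\<close>.\<close>

lemma slot_gap:
  fixes z V :: "nat \<Rightarrow> complex"
  assumes "(\<Sum>t<N. (cmod (z t - V t))\<^sup>2) \<le> (\<Sum>t<N. (cmod (z t))\<^sup>2)"
  shows "(\<Sum>t<N. (cmod (V t))\<^sup>2) \<le> 2 * (\<Sum>t<N. Re (V t) * Re (z t) + Im (V t) * Im (z t))"
proof -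
  have "(\<Sum>t<N. (cmod (z t - V t))\<^sup>2)
     = (\<Sum>t<N. (cmod (z t))\<^sup>2 + (cmod (V t))\<^sup>2 - 2 * (Re (V t) * Re (z t) + Im (V t) * Im (z t)))"
    by (intro sum.cong refl) (simp only: cmod_power2, simp add: power2_eq_square algebra_simps)
  then show ?thesis
    using assms by (simp add: sum.distrib sum_subtractf sum_distrib_left)
qed

text \<open>Union bound over the competitors \<open>m'\<close>: each wins only if the noise is at
  least as close to the scaled codeword difference \<open>V m'\<close> as to 0. Only the bound
  \<open>a\<close> on the channel magnitude from below enters, so one code serves every admissible
  channel.\<close>

lemma tdma_err_le:
  assumes H: "admissible a b H" and a: "0 < a" and m: "w d < M"
  shows "measure (noise_space (5 * n)) (err_event (5 * n) H (tdma_enc f) (tdma_dec f (5 * n) M) c d w w')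
    \<le> (\<Sum>m'\<in>{..<M} - {w d}. overlap (a\<^sup>2 / 4) n (f (w d)) (f m'))"
proof -
  interpret noise: prob_space "noise_space (5 * n)" by (rule prob_space_noise)
  define N where "N = 5 * n"
  define s where "s = silent (nb c d)"
  define h where "h = H (c, d) c"
  define V where "V = (\<lambda>m' t. if t mod 5 = s then h t * (symbol (f m') (t div 5) - symbol (f (w d)) (t div 5)) else 0)"
  define E where "E = (\<lambda>m'. {g \<in> space (noise_space N).
      (\<Sum>t<N. (cmod (cnoise g t - V m' t))\<^sup>2) \<le> (\<Sum>t<N. (cmod (cnoise g t))\<^sup>2)})"
  have E_sets: "E m' \<in> sets (noise_space N)" for m'
  proof -
    have [measurable]: "(\<lambda>g. \<Sum>t<N. (cmod (cnoise g t - x t))\<^sup>2) \<in> borel_measurable (noise_space N)" for x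
    proof (intro borel_measurable_sum)
      fix t assume "t \<in> {..<N}"
      then have [measurable]: "(\<lambda>g. cnoise g t) \<in> borel_measurable (noise_space N)"
        by (intro measurable_cnoise) auto
      show "(\<lambda>g. (cmod (cnoise g t - x t))\<^sup>2) \<in> borel_measurable (noise_space N)" by measurable
    qed
    from this[of "\<lambda>_. 0"] have [measurable]:
      "(\<lambda>g. \<Sum>t<N. (cmod (cnoise g t))\<^sup>2) \<in> borel_measurable (noise_space N)" by simp
    show ?thesis unfolding E_def by measurable
  qed
  have h: "a \<le> cmod (h t)" for t
    using H unfolding admissible_def h_def by (metis hears_def fst_conv)
  have E_le: "measure (noise_space N) (E m') \<le> overlap (a\<^sup>2 / 4) n (f (w d)) (f m')" for m'
  proof -
    have "measure (noise_space N) (E m') \<le> exp (- (\<Sum>i<2*N. (coords (V m') i)\<^sup>2) / 4)"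
    proof (rule gauss_chernoff)
      fix g assume "g \<in> E m'"
      then have "(\<Sum>t<N. (cmod (V m' t))\<^sup>2)
          \<le> 2 * (\<Sum>t<N. Re (V m' t) * Re (cnoise g t) + Im (V m' t) * Im (cnoise g t))"
        by (intro slot_gap) (simp add: E_def)
      then show "(\<Sum>i<2*N. (coords (V m') i)\<^sup>2) \<le> 2 * (\<Sum>i<2*N. coords (V m') i * g i)"
        unfolding sum_coords_sq by (simp add: sum_double coords_def cnoise_def)
    qed (auto simp: E_def)
    also have "\<dots> \<le> exp (- (a\<^sup>2 * (\<Sum>\<tau><n. (cmod (symbol (f m') \<tau> - symbol (f (w d)) \<tau>))\<^sup>2)) / 4)"
    proof -
      have "a\<^sup>2 * (\<Sum>\<tau><n. (cmod (symbol (f m') \<tau> - symbol (f (w d)) \<tau>))\<^sup>2)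
         = (\<Sum>t<N. if t mod 5 = s then a\<^sup>2 * (cmod (symbol (f m') (t div 5) - symbol (f (w d)) (t div 5)))\<^sup>2 else 0)"
        unfolding N_def using silent_less by (subst sum_slot) (auto simp: s_def sum_distrib_left)
      also have "\<dots> \<le> (\<Sum>t<N. (cmod (V m' t))\<^sup>2)"
        using h a by (intro sum_mono) (auto simp: V_def norm_mult power_mult_distrib intro!: mult_right_mono power_mono)
      finally show ?thesis by (simp add: sum_coords_sq)
    qed
    also have "(\<Sum>\<tau><n. (cmod (symbol (f m') \<tau> - symbol (f (w d)) \<tau>))\<^sup>2)
        = (\<Sum>i<2*n. (real (f (w d) i) - real (f m' i))\<^sup>2)"
      by (simp add: sum_double symbol_def cmod_power2 power2_commute)
    finally show ?thesis by (simp add: overlap_def)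
  qed
  have "err_event N H (tdma_enc f) (tdma_dec f N M) c d w w' \<subseteq> (\<Union>m'\<in>{..<M} - {w d}. E m')"
  proof
    fix g assume g: "g \<in> err_event N H (tdma_enc f) (tdma_dec f N M) c d w w'"
    define y where "y = received N H c d (tdma_enc f c w) (tdma_enc f (nb c d) w') g"
    have "tdma_dec f N M (c, d) (csir N H (c, d) c) (csir N H (c, d) (nb c d)) y \<noteq> w d"
      using g by (simp add: err_event_def y_def)
    from tdma_dec_neqD[OF this m] obtain m' where m': "m' \<in> {..<M} - {w d}"
      and le: "slot_dist f N s (csir N H (c, d) c) y m' \<le> slot_dist f N s (csir N H (c, d) c) y (w d)"
      by (auto simp: s_def)
    \<comment> \<open>In these slots the neighbour is silent and the cell itself serves direction
      \<open>d\<close>, so no interference remains.\<close>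
    have diff: "y t - csir N H (c, d) c t * symbol (f k) (t div 5) = cnoise g t - V k t"
      if "t < N" "t mod 5 = s" for t k
      using that tdma_enc_active[of t c d] tdma_enc_silent[of t "nb c d"]
      by (simp add: y_def received_def csir_def s_def V_def h_def algebra_simps)
    \<comment> \<open>\<open>V\<close> vanishes outside the listening slots. Adding their noise
      energy \<open>F\<close> to both distances extends the comparison to the whole block, where the
      Chernoff bound applies.\<close>
    define F where "F = (\<Sum>t<N. if t mod 5 = s then 0 else (cmod (cnoise g t))\<^sup>2)"
    have met: "slot_dist f N s (csir N H (c, d) c) y k + F = (\<Sum>t<N. (cmod (cnoise g t - V k t))\<^sup>2)" for k
      unfolding slot_dist_def F_def sum.distrib[symmetric]
      by (intro sum.cong refl) (auto simp: diff, simp add: V_def)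
    have "(\<Sum>t<N. (cmod (cnoise g t - V (w d) t))\<^sup>2) = (\<Sum>t<N. (cmod (cnoise g t))\<^sup>2)"
      by (intro sum.cong) (auto simp: V_def)
    then have "g \<in> E m'"
      using le met[of m'] met[of "w d"] g by (simp add: E_def err_event_def)
    then show "g \<in> (\<Union>m'\<in>{..<M} - {w d}. E m')" using m' by blast
  qed
  then have "measure (noise_space N) (err_event N H (tdma_enc f) (tdma_dec f N M) c d w w')
      \<le> measure (noise_space N) (\<Union>m'\<in>{..<M} - {w d}. E m')"
    using E_sets by (intro finite_measure.finite_measure_mono) (auto simp: N_def noise.finite_measure_axioms)
  also have "\<dots> \<le> (\<Sum>m'\<in>{..<M} - {w d}. measure (noise_space N) (E m'))"
    using E_sets by (intro measure_UNION_le) auto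
  also have "\<dots> \<le> (\<Sum>m'\<in>{..<M} - {w d}. overlap (a\<^sup>2 / 4) n (f (w d)) (f m'))"
    by (intro sum_mono E_le)
  finally show ?thesis by (simp add: N_def)
qed

text \<open>Each of the four messages of a cell is active in one fifth of the block and carries
  \<open>ln (real q / C)\<close> per real coordinate, two per channel use: 4 * 2 / 5 = 8 /
  5.\<close>

lemma achievable_tdma:
  assumes a: "0 < a" and q: "1 \<le> q" and P: "2 * (real q)\<^sup>2 \<le> P"
  defines "C \<equiv> 2 / (1 - exp (- (a\<^sup>2 / 4)))"
  shows "achievable a b P (8 / 5 * ln (real q / C))"
  unfolding achievable_def
proof (intro allI impI)
  fix \<epsilon> :: real assume \<epsilon>: "0 < \<epsilon>"
  have C: "0 < C" using a by (simp add: C_def)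
  define L where "L = 2 * ln (real q / C)"
  have "(\<lambda>n. exp (- \<epsilon> * real n)) \<longlonglongrightarrow> 0" using \<epsilon> by real_asymp
  then have "eventually (\<lambda>n. exp (- \<epsilon> * real n) < \<epsilon>) sequentially"
    using \<epsilon> by (rule order_tendstoD)
  moreover have "eventually (\<lambda>n. 0 < n) sequentially" by (rule eventually_gt_at_top)
  ultimately have "eventually (\<lambda>n. exp (- \<epsilon> * real n) < \<epsilon> \<and> 0 < n) sequentially"
    by (rule eventually_conj)
  then obtain n where n: "exp (- \<epsilon> * real n) < \<epsilon>" "0 < n"
    using eventually_happens by force
  \<comment> \<open>With the successor of the floor, \<open>M\<close> is large enough for the rate,
    while \<open>real M - 1\<close>, the quantity in the greedy bound, is small enough for the
    error. It also keeps \<open>M\<close> positive.\<close>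
  define M where "M = Suc (nat \<lfloor>exp (real n * (L - \<epsilon>))\<rfloor>)"
  have M: "exp (real n * (L - \<epsilon>)) \<le> real M" "real M - 1 \<le> exp (real n * (L - \<epsilon>))"
    unfolding M_def by (simp_all add: of_nat_floor, linarith)
  let ?X = "PiE {..<2*n} (\<lambda>_. {..<q})"
  have "\<exists>f. (\<forall>i. f i \<in> ?X) \<and>
      (\<Sum>i<M. \<Sum>j\<in>{..<M} - {i}. overlap (a\<^sup>2 / 4) n (f i) (f j))
        \<le> real M * (real M - 1) * (C ^ (2 * n) / real (card ?X))"
  proof (rule greedy_codebook)
    show "finite ?X" by (intro finite_PiE) auto
    show "?X \<noteq> {}" using q by (auto simp: PiE_eq_empty_iff lessThan_empty_iff)
    show "overlap (a\<^sup>2 / 4) n x y = overlap (a\<^sup>2 / 4) n y x" for x y by (rule overlap_commute)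
    show "(\<Sum>y\<in>?X. overlap (a\<^sup>2 / 4) n x y) \<le> C ^ (2 * n)" for x
      unfolding C_def by (rule sum_overlap_le) (use a in simp)
  qed
  then obtain f where f: "\<And>i. f i \<in> ?X"
    and f_sum: "(\<Sum>i<M. \<Sum>j\<in>{..<M} - {i}. overlap (a\<^sup>2 / 4) n (f i) (f j))
        \<le> real M * (real M - 1) * (C ^ (2 * n) / real (card ?X))"
    by blast
  have ratio: "C ^ (2 * n) / real (card ?X) = exp (- real n * L)"
  proof -
    have "exp (- real n * L) = exp (ln (C / real q)) ^ (2 * n)"
      using C q by (simp add: exp_of_nat_mult[symmetric] L_def ln_div algebra_simps)
    also have "\<dots> = C ^ (2 * n) / real (card ?X)"
      using C q by (simp add: card_PiE power_divide)
    finally show ?thesis by simp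
  qed
  have "(real M - 1) * exp (- real n * L) \<le> exp (real n * (L - \<epsilon>)) * exp (- real n * L)"
    using M by (intro mult_right_mono) auto
  also have "\<dots> = exp (- \<epsilon> * real n)"
    by (simp add: exp_add[symmetric] algebra_simps)
  finally have small: "(real M - 1) * exp (- real n * L) \<le> \<epsilon>" using n by simp
  define Ms :: "cell \<Rightarrow> dir \<Rightarrow> nat" where "Ms = (\<lambda>_ _. M)"
  \<comment> \<open>Only the average of \<open>pe\<close> over the codewords is small, which is what
    \<open>err_prob\<close> measures.\<close>
  define pe where "pe = (\<lambda>i. \<Sum>j\<in>{..<M} - {i}. overlap (a\<^sup>2 / 4) n (f i) (f j))"
  have pe_sum: "(\<Sum>i<M. pe i) \<le> real M * \<epsilon>"
  proof -
    have "(\<Sum>i<M. pe i) \<le> real M * ((real M - 1) * exp (- real n * L))"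
      using f_sum unfolding pe_def ratio by (simp only: mult.assoc)
    also have "\<dots> \<le> real M * \<epsilon>" using small by (intro mult_left_mono) auto
    finally show ?thesis .
  qed
  have "0 < real M" using M(1) by (rule less_le_trans[OF exp_gt_zero])
  then have "real n * (L - \<epsilon>) \<le> ln (real M)"
    using M(1) by (simp only: ln_ge_iff)
  then have rate: "L - \<epsilon> \<le> ln (real M) / real n"
    using n by (simp add: pos_le_divide_eq mult.commute)
  \<comment> \<open>The four messages together lose 4/5 of \<open>\<epsilon>\<close> in
    rate.\<close>
  have sum_rate: "8 / 5 * ln (real q / C) - \<epsilon>
      \<le> (\<Sum>d\<in>{East, West, North, South}. ln (real (Ms c d)) / real (5 * n))" for c
    using rate \<epsilon> by (simp add: Ms_def L_def)
  have power: "(\<Sum>w\<in>msgs Ms c. (cmod (tdma_enc f c w t))\<^sup>2) \<le> P * real (card (msgs Ms c))"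
    if "t < 5 * n" for c t
    using sum_mono[of "msgs Ms c" "\<lambda>w. (cmod (tdma_enc f c w t))\<^sup>2" "\<lambda>_. P"]
      cmod_tdma_enc_le[OF f that P] by (simp add: mult.commute)
  have err: "err_prob (5 * n) Ms H (tdma_enc f) (tdma_dec f (5 * n) M) c d \<le> \<epsilon>"
    if H: "admissible a b H" for H c d
  proof -
    let ?W = "msgs Ms c" and ?W' = "msgs Ms (nb c d)"
    have pos: "0 < card (msgs Ms c)" for c
      using msgs_ne[of Ms c] by (simp add: card_gt_0_iff Ms_def M_def)
    have "(\<Sum>w\<in>?W. \<Sum>w'\<in>?W'. measure (noise_space (5 * n))
        (err_event (5 * n) H (tdma_enc f) (tdma_dec f (5 * n) M) c d w w'))
      \<le> (\<Sum>w\<in>?W. \<Sum>w'\<in>?W'. pe (w d))"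
      unfolding pe_def
      by (intro sum_mono tdma_err_le[OF H a]) (auto simp: msgs_def Ms_def)
    also have "\<dots> = real (card ?W') * (\<Sum>w\<in>?W. pe (w d))"
      by (simp add: sum_distrib_left)
    also have "(\<Sum>w\<in>?W. pe (w d)) = real (card (PiE (UNIV - {d}) (\<lambda>d. {..<Ms c d}))) * (\<Sum>i<M. pe i)"
      by (subst sum_msgs_fibre[where d = d]) (simp add: Ms_def)
    also have "\<dots> \<le> real (card (PiE (UNIV - {d}) (\<lambda>d. {..<Ms c d}))) * (real M * \<epsilon>)"
      by (intro mult_left_mono pe_sum) auto
    also have "\<dots> = real (card ?W) * \<epsilon>"
      by (simp add: card_msgs_fibre[of Ms c d]) (simp add: Ms_def)
    finally have "(\<Sum>w\<in>?W. \<Sum>w'\<in>?W'. measure (noise_space (5 * n))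
        (err_event (5 * n) H (tdma_enc f) (tdma_dec f (5 * n) M) c d w w'))
      \<le> real (card ?W') * (real (card ?W) * \<epsilon>)"
      by (simp add: mult_left_mono)
    then show ?thesis
      using pos[of c] pos[of "nb c d"]
      by (simp add: err_prob_def divide_le_eq mult_ac)
  qed
  show "\<exists>N M enc dec. N > 0 \<and> (\<forall>c d. M c d \<ge> 1) \<and>
         (\<forall>c. (\<Sum>d\<in>{East, West, North, South}. ln (real (M c d)) / real N) \<ge> 8 / 5 * ln (real q / C) - \<epsilon>) \<and>
         (\<forall>c. \<forall>n<N. (\<Sum>w\<in>msgs M c. (cmod (enc c w n))\<^sup>2) \<le> P * real (card (msgs M c))) \<and>
         (\<forall>H. admissible a b H \<longrightarrow>
            (\<forall>c d. (\<forall>w\<in>msgs M c. \<forall>w'\<in>msgs M (nb c d).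
                      err_event N H enc dec c d w w' \<in> sets (noise_space N)) \<and>
                   err_prob N M H enc dec c d \<le> \<epsilon>))"
  proof (rule exI[of _ "5 * n"], rule exI[of _ Ms], rule exI[of _ "tdma_enc f"],
      rule exI[of _ "tdma_dec f (5 * n) M"], intro conjI allI impI ballI)
    show "0 < 5 * n" using n by simp
    show "1 \<le> Ms c d" for c d by (simp add: Ms_def M_def)
  qed ((rule sum_rate tdma_err_event_sets) | (rule power err, assumption))+
qed

section \<open>The limit\<close>

theorem theorem2:
  fixes a b :: real
  assumes "0 < a" and "a \<le> b"
  shows "((\<lambda>P. sym_capacity a b P / ln P) \<longlongrightarrow> 4 / 5) at_top"
proof (rule tendsto_sandwich)
  define C where "C = 2 / (1 - exp (- (a\<^sup>2 / 4)))"
  have C: "0 < C" using assms by (simp add: C_def)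
  define c1 where "c1 = ln (8 * a\<^sup>2)"
  let ?upper = "\<lambda>P. 4 / 5 * (ln P + c1 + 4 + ln 2) + 1 / 20"
  \<comment> \<open>The first condition makes \<open>sqrt (P / 2)\<close> exceed 2 and
    \<open>ln P\<close> positive; the second is the power condition of
    \<open>achievable_upper\<close>.\<close>
  have large: "eventually (\<lambda>P. 8 < P \<and> 1 / (4 * a\<^sup>2) \<le> P) at_top"
    by (intro eventually_conj eventually_gt_at_top eventually_ge_at_top)
  have bounds: "8 / 5 * ln ((sqrt (P / 2) - 1) / C) \<le> sym_capacity a b P \<and> sym_capacity a b P \<le> ?upper P"
    if P: "8 < P" "1 / (4 * a\<^sup>2) \<le> P" for P
  proof -
    \<comment> \<open>The largest grid side with \<open>2 * (real q)\<^sup>2 \<le> P\<close>. It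
      grows like the square root of \<open>P\<close>, so 8/5 of its logarithm is 4/5 of
      \<open>ln P\<close> up to a bounded term.\<close>
    define q where "q = nat \<lfloor>sqrt (P / 2)\<rfloor>"
    have "sqrt (2\<^sup>2) < sqrt (P / 2)" using P by (intro real_sqrt_less_mono) simp
    then have s: "2 < sqrt (P / 2)" by simp
    then have q: "1 \<le> q" "real q \<le> sqrt (P / 2)" "sqrt (P / 2) - 1 \<le> real q"
      unfolding q_def by linarith+
    have "2 * (real q)\<^sup>2 \<le> 2 * (sqrt (P / 2))\<^sup>2"
      using q by (intro mult_left_mono power_mono) auto
    then have "2 * (real q)\<^sup>2 \<le> P" using P by simp
    then have ach: "achievable a b P (8 / 5 * ln (real q / C))"
      unfolding C_def using assms(1) q(1) by (intro achievable_tdma)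
    have up: "R \<le> ?upper P" if "achievable a b P R" for R
      unfolding c1_def using assms P that by (intro achievable_upper) (auto simp: field_simps)
    have "8 / 5 * ln (real q / C) \<le> sym_capacity a b P"
      unfolding sym_capacity_def using ach up
      by (intro cSup_upper) (auto intro!: bdd_aboveI[of _ "?upper P"])
    moreover have "ln ((sqrt (P / 2) - 1) / C) \<le> ln (real q / C)"
    proof (rule ln_mono)
      show "0 < (sqrt (P / 2) - 1) / C" using C s by (intro divide_pos_pos) linarith+
    qed (use C q in \<open>intro divide_right_mono; simp\<close>)
    moreover have "sym_capacity a b P \<le> ?upper P"
      unfolding sym_capacity_def using ach up by (intro cSup_least) auto
    ultimately show ?thesis by linarith
  qed
  show "eventually (\<lambda>P. 8 / 5 * ln ((sqrt (P / 2) - 1) / C) / ln P \<le> sym_capacity a b P / ln P) at_top"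
    using large
  proof eventually_elim
    case (elim P)
    then show ?case
      using bounds[of P] by (intro divide_right_mono) (auto intro: ln_ge_zero)
  qed
  show "eventually (\<lambda>P. sym_capacity a b P / ln P \<le> ?upper P / ln P) at_top"
    using large
  proof eventually_elim
    case (elim P)
    then show ?case
      using bounds[of P] by (intro divide_right_mono) (auto intro: ln_ge_zero)
  qed
  show "((\<lambda>P. 8 / 5 * ln ((sqrt (P / 2) - 1) / C) / ln P) \<longlongrightarrow> 4 / 5) at_top"
    using C by real_asymp
  show "((\<lambda>P. ?upper P / ln P) \<longlongrightarrow> 4 / 5) at_top"
    by real_asymp
qed

end
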